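(* Let $k\geq 3$ be an integer and let $G$ be a 2-connected non-bipartite graph with minimum degree $\delta(G)\geq 2k$. Then $|L_o(G)|\geq k$. Moreover, if $|L_o(G)|=k$, then $2|L_o(G)|+1=\ell_o(G)$, and either $K_{2k+1}\subseteq G$ or $\chi(G)\leq 2k$.
   Context: All graphs are finite, simple and undirected. $L_o(G)$ denotes the set of all odd integers $m$ such that $G$ contains a cycle of length $m$. For a non-bipartite graph $G$, $\ell_o(G)$ denotes the length of a longest odd cycle in $G$. $\chi(G)$ is the chromatic number. $K_{m}\subseteq G$ means that $G$ contains a complete subgraph on $m$ vertices. *)

theory Defs
  imports "Graph_Theory.Graph_Theory"
begin

text \<open>
  Finite simple undirected graphs are rendered by the library locale \<^locale>\<open>graph\<close>: finite,
  loop-free digraphs without parallel arcs whose arc relation is symmetric. An undirected edge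
  thus corresponds to a pair of opposite arcs, and the degree of a vertex is its out-degree.
\<close>

definition min_degree :: "('a, 'b) pre_digraph \<Rightarrow> nat" where
  "min_degree G = Min (out_degree G ` verts G)"

text \<open>
  The library notion of connectedness excludes the graph without vertices. It is written with its
  qualified name because topological connectedness has the same base name.
\<close>

definition k_connected :: "nat \<Rightarrow> ('a, 'b) pre_digraph \<Rightarrow> bool" where
  "k_connected k G \<longleftrightarrow> k < card (verts G) \<and>
    (\<forall>X \<subseteq> verts G. card X < k \<longrightarrow> Digraph_Component.connected (G \<restriction> (verts G - X)))"

definition bipartite :: "('a, 'b) pre_digraph \<Rightarrow> bool" where
  "bipartite G \<longleftrightarrow> (\<exists>A B. A \<union> B = verts G \<and> A \<inter> B = {} \<and>
    (\<forall>(u, v) \<in> arcs_ends G. u \<in> A \<and> v \<in> B \<or> u \<in> B \<and> v \<in> A))"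

definition proper_coloring :: "('a, 'b) pre_digraph \<Rightarrow> nat \<Rightarrow> ('a \<Rightarrow> nat) \<Rightarrow> bool" where
  "proper_coloring G n c \<longleftrightarrow>
    (\<forall>v \<in> verts G. c v < n) \<and> (\<forall>(u, v) \<in> arcs_ends G. c u \<noteq> c v)"

definition chromatic_number :: "('a, 'b) pre_digraph \<Rightarrow> nat" where
  "chromatic_number G = (LEAST n. \<exists>c. proper_coloring G n c)"

text \<open>
  A directed cycle of length two runs along an edge and back and is not a cycle of the undirected
  graph; hence the lower bound on the length.
\<close>

definition cycle_of_length :: "('a, 'b) pre_digraph \<Rightarrow> nat \<Rightarrow> bool" where
  "cycle_of_length G m \<longleftrightarrow> 3 \<le> m \<and> (\<exists>p. pre_digraph.cycle G p \<and> length p = m)"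

definition odd_cycle_lengths :: "('a, 'b) pre_digraph \<Rightarrow> nat set" where
  "odd_cycle_lengths G = {m. odd m \<and> cycle_of_length G m}"

text \<open>The maximum is meaningful only for non-bipartite finite graphs.\<close>

definition longest_odd_cycle_length :: "('a, 'b) pre_digraph \<Rightarrow> nat" where
  "longest_odd_cycle_length G = Max (odd_cycle_lengths G)"

definition contains_complete :: "('a, 'b) pre_digraph \<Rightarrow> nat \<Rightarrow> bool" where
  "contains_complete G m \<longleftrightarrow> (\<exists>H. subgraph H G \<and> complete_digraph m H)"

end

theory Submission
  imports Defs
begin

text \<open>
  Assume that there are at most $k$ odd cycle lengths. Let $x_0, \ldots, x_N$ be a longest path, so
  that all neighbours of $x_0$ lie on it.

  If for every longest path $x_0$ only has neighbours of odd index, let $x_r$ be the last of them. The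
  even cycle $x_0 \ldots x_r$ has an odd ear because the graph is 2-connected and not bipartite. The
  chords at $x_0$, taken in pairs, together with the ear give odd cycles whose lengths contain
  sumsets of total size too big for $k \geq 4$; for $k = 3$ the few tight configurations are
  excluded by one longer cycle.

  Otherwise choose the longest path such that $x_0$ has a neighbour $x_{2m}$ of even index with $m$
  maximal. On the odd cycle $x_0 \ldots x_{2m}$ every chord at $x_0$ cuts off one odd cycle, and
  each length arises from at most two chords, which accounts for $k$ lengths. Combining two
  chords at $x_0$, or chords at $x_0$ and at $x_{2m-1}$, shows that the set of lengths obtained is
  closed under reflected addition, and this forces it to be $3, 5, \ldots, 2m+1$ with
  $m = k$. Then all but at most one of the chords at $x_0$ are present, and 2-connectivity leaves room for at
  most one vertex outside the cycle. A graph with at most $2k + 2$ vertices and minimum degree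
  at least $2k$ is the complement of a matching: if the matching has at most one edge, there is
  a $K_{2k+1}$, and otherwise two of its edges are colour classes that save two colours.
\<close>

section \<open>Sets of integers closed under reflected addition\<close>

text \<open>An odd length is coded by the number of steps of two by which it falls short of 2m + 1,
  so that combining two chords adds their codes. Two chords at \<open>x 0\<close>, one with an even
  and one with an odd end, share each code; so 2k chords use up k lengths. The obstacle is a chord
  from \<open>x 0\<close> to a vertex beyond the cycle, which this pairing does not cover.
  Maximality of m makes all such outer ends odd, and rotating the path along the closing chord gives
  a second start \<open>x (2 * m - 1)\<close>, also adjacent to \<open>x (2 * m)\<close>. Two
  different outer ends, one seen from each start, yield an odd cycle longer than 2m + 1, which costs
  a length. Weighing outer ends against longer cycles leaves at most one outer end, at a known
  place. It spoils the pairing for one chord per start, hence the version of closure that tolerates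
  one gap on either side. In the case of the even cycle, the chords fall into three classes with a +
  b \<le> k + 1 for any two of the sizes and a total of at least 2k. So 4k \<le> 3k + 3, which makes
  k = 3 the tight value.\<close>

text \<open>
  The chords of codes \<open>f\<close> and \<open>g\<close> at a vertex of a cycle of length \<open>2 * m + 1\<close> bound an odd cycle
  of code \<open>f + g\<close>, or \<open>2 * m - 1 - (f + g)\<close> if their ends come in the opposite order.
\<close>

definition fold_mem :: "int \<Rightarrow> int set \<Rightarrow> int \<Rightarrow> bool" where
  "fold_mem m F s \<longleftrightarrow> (if s < m then s \<in> F else 2 * m - 1 - s \<in> F)"

lemma fold_top:
  fixes F :: "int set"
  assumes F: "F \<subseteq> {0..<m}" and r: "r \<in> F" "0 < r" "\<And>f. f \<in> F \<Longrightarrow> f \<le> r"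
    and c2: "\<And>f. f \<in> F \<Longrightarrow> f \<noteq> r \<Longrightarrow> fold_mem m F (r + f)"
    and w: "\<exists>f\<in>F. 0 < f \<and> fold_mem m F (r + f)"
    and c7: "r \<le> m - 2 \<Longrightarrow> fold_mem (m - 1) F (2 * r)"
  shows "r = m - 1"
proof (rule ccontr)
  assume "r \<noteq> m - 1"
  with F r have le: "r \<le> m - 2" by fastforce
  have n: "s \<notin> F" if "s > r" for s using r(3)[of s] that by auto
  have "2 * m - 3 - 2 * r \<in> F"
    using c7[OF le] n[of "2 * r"] r(2) by (auto simp: fold_mem_def split: if_splits)
  then obtain d where d: "d \<in> F" "d = 2 * m - 3 - 2 * r" by blast
  have "d \<ge> 0" using d(1) F by auto
  then have "d > 0" using d(2) by presburger
  show False
  proof (cases "d = r")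
    case False
    show False using c2[OF d(1) False] n[of "r + d"] n[of "2 * m - 1 - (r + d)"] d(2) \<open>d > 0\<close>
      by (auto simp: fold_mem_def split: if_splits)
  next
    case True
    obtain f where f: "f \<in> F" "0 < f" "fold_mem m F (r + f)" using w by blast
    then show False using n[of "r + f"] n[of "2 * m - 1 - (r + f)"] r(3)[of f] d(2) True
      by (auto simp: fold_mem_def split: if_splits)
  qed
qed

lemma up_closed_full:
  fixes F :: "int set"
  assumes "F \<subseteq> {0..<m}" "1 \<in> F" "0 \<in> F" and up: "\<And>f. f \<in> F \<Longrightarrow> 1 \<le> f \<Longrightarrow> f + 1 < m \<Longrightarrow> f + 1 \<in> F"
  shows "F = {0..<m}"
proof -
  have "i < m \<longrightarrow> i \<in> F" if "i \<ge> 1" for i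
    using that by (induction i rule: int_ge_induct) (use assms in auto)
  then have "i \<in> F" if "0 \<le> i" "i < m" for i using that assms(3) by (cases "i = 0") auto
  then show ?thesis using assms(1) by fastforce
qed

text \<open>The top element is \<open>m - 1\<close>, its double reflects to \<open>1\<close>, and
  adding \<open>1\<close> repeatedly fills the interval.\<close>

lemma fold_closed_full:
  fixes F :: "int set"
  assumes fin: "finite F" and F: "F \<subseteq> {0..<m}" and card: "2 \<le> card F" and z: "0 \<in> F"
    and c2: "\<And>f g. f \<in> F \<Longrightarrow> g \<in> F \<Longrightarrow> fold_mem m F (f + g)"
    and c7: "\<And>f g. f \<in> F \<Longrightarrow> g \<in> F \<Longrightarrow> f \<le> m - 2 \<Longrightarrow> g \<le> m - 2 \<Longrightarrow> fold_mem (m - 1) F (f + g)"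
  shows "F = {0..<m}"
proof -
  define r where "r = Max F"
  have r: "r \<in> F" "\<And>f. f \<in> F \<Longrightarrow> f \<le> r" using fin z unfolding r_def by (auto intro: Max_in)
  have "r > 0"
  proof (rule ccontr)
    assume "\<not> r > 0"
    then have "F \<subseteq> {0}" using r F by force
    then have "card F \<le> 1" using card_mono[of "{0}" F] by simp
    then show False using card by simp
  qed
  have rm: "r = m - 1"
    by (rule fold_top[OF F r(1) \<open>r > 0\<close> r(2)])
       (use c2 c7[of r r] r \<open>r > 0\<close> in auto)
  have "1 \<in> F" using c2[OF r(1) r(1)] rm \<open>r > 0\<close> by (auto simp: fold_mem_def split: if_splits)
  then show ?thesis
    by (intro up_closed_full[OF F _ z]) (use c2[OF _ \<open>1 \<in> F\<close>] in \<open>auto simp: fold_mem_def split: if_splits\<close>)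
qed

text \<open>
  Here \<open>A\<close>, \<open>B\<close> (and \<open>A'\<close>, \<open>B'\<close>) will be the even and the odd chords at one (and the other)
  neighbour of the last vertex of an odd cycle. Each pair misses at most one element of \<open>F\<close>, so
  closure can only fail for an element \<open>h + h\<close> with \<open>h\<close> missing on both sides.
\<close>

lemma fold_almost_closed_full:
  fixes F A B A' B' :: "int set"
  assumes fin: "finite F" and F: "F \<subseteq> {0..<m}" and card: "3 \<le> card F" and z: "0 \<in> F"
    and AB: "A \<union> B = F" "A' \<union> B' = F"
    and bad: "\<And>f g. f \<in> F \<Longrightarrow> g \<in> F \<Longrightarrow> f \<notin> A \<inter> B \<Longrightarrow> g \<notin> A \<inter> B \<Longrightarrow> f = g"
             "\<And>f g. f \<in> F \<Longrightarrow> g \<in> F \<Longrightarrow> f \<notin> A' \<inter> B' \<Longrightarrow> g \<notin> A' \<inter> B' \<Longrightarrow> f = g"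
    and c2: "\<And>f g. f \<in> A \<Longrightarrow> g \<in> B \<Longrightarrow> fold_mem m F (f + g)"
            "\<And>f g. f \<in> A' \<Longrightarrow> g \<in> B' \<Longrightarrow> fold_mem m F (f + g)"
    and c7: "\<And>f g. f \<in> B \<Longrightarrow> g \<in> B' \<Longrightarrow> f \<le> m - 2 \<Longrightarrow> g \<le> m - 2 \<Longrightarrow> fold_mem (m - 1) F (f + g)"
    and R: "R \<in> F" "\<And>f. f \<in> A \<Longrightarrow> R - f \<in> F" "\<And>f. f \<in> A' \<Longrightarrow> R - f \<in> F"
    and c5: "\<And>f g. f \<in> A \<Longrightarrow> 1 \<le> f \<Longrightarrow> g \<in> B' \<Longrightarrow> g \<le> m - 2 \<Longrightarrow> R - 1 - \<bar>g + 1 - f\<bar> \<in> F"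
            "\<And>f g. f \<in> A' \<Longrightarrow> 1 \<le> f \<Longrightarrow> g \<in> B \<Longrightarrow> g \<le> m - 2 \<Longrightarrow> R - 1 - \<bar>g + 1 - f\<bar> \<in> F"
  shows "F = {0..<m} \<and> R = m - 1"
proof -
  define H where "H = {h \<in> F. h \<notin> A \<inter> B \<and> h \<notin> A' \<inter> B'}"
  have H1: "f = g" if "f \<in> H" "g \<in> H" for f g using that bad(1) unfolding H_def by blast
  define r where "r = Max F"
  have r: "r \<in> F" "\<And>f. f \<in> F \<Longrightarrow> f \<le> r" using fin z unfolding r_def by (auto intro: Max_in)
  have nr: "s \<notin> F" if "s > r" for s using r(2)[of s] that by auto
  have n0: "s \<notin> F" if "s < 0" for s using F that by auto
  have rm1: "r \<le> m - 1" using F r(1) by fastforce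
  obtain f0 where f0: "f0 \<in> F" "f0 \<noteq> 0" "f0 \<noteq> r"
  proof -
    have "\<not> F \<subseteq> {0, r}"
    proof
      assume "F \<subseteq> {0, r}"
      then have "card F \<le> card {0, r}" by (intro card_mono) auto
      also have "\<dots> \<le> 2" by (simp add: card_insert_if)
      finally show False using card by simp
    qed
    then show ?thesis using that by blast
  qed
  have f0b: "0 < f0" "f0 < r" using F f0 r(2)[of f0] by fastforce+
  have m3: "m \<ge> 3" using rm1 f0b by simp
  \<comment> \<open>Of two different elements one lies in both \<open>A\<close> and
    \<open>B\<close>, so only a double can fail.\<close>
  have d2: "fold_mem m F (f + g)" if fg: "f \<in> F" "g \<in> F" "f \<noteq> g \<or> f \<notin> H" for f g
  proof (cases "f = g")
    case True
    then have "f \<in> A \<inter> B \<or> f \<in> A' \<inter> B'" using fg unfolding H_def by auto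
    then show ?thesis using c2 True by blast
  next
    case False
    then have "f \<in> A \<inter> B \<or> g \<in> A \<inter> B" using bad(1)[OF fg(1,2)] by blast
    then have "(f \<in> A \<and> g \<in> B) \<or> (g \<in> A \<and> f \<in> B)" using AB(1) fg by blast
    then show ?thesis using c2(1)[of f g] c2(1)[of g f] by (auto simp: add.commute)
  qed
  \<comment> \<open>For \<open>g = f\<close> the value in \<open>c5\<close> is \<open>R - 2\<close>,
    whatever \<open>f\<close> is.\<close>
  have s2: "R - 2 \<in> F" if f: "f \<in> F" "1 \<le> f" "f \<le> m - 2" "f \<notin> H" for f
  proof -
    have "(f \<in> A \<and> f \<in> B') \<or> (f \<in> A' \<and> f \<in> B)"
      using f AB unfolding H_def by blast
    then show ?thesis using c5(1)[of f f] c5(2)[of f f] f by auto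
  qed
  \<comment> \<open>Either \<open>A\<close> and \<open>A'\<close> cover \<open>F\<close>, and then
    \<open>R - f\<close> maps all of \<open>F\<close> to itself; or both lack the same
    \<open>h\<close>, and then \<open>B\<close> and \<open>B'\<close> lack nothing, so that
    \<open>c7\<close> applies to all pairs up to \<open>m - 2\<close>.\<close>
  have top: "r = m - 1 \<and> ((\<forall>f\<in>F. R - f \<in> F) \<or> (\<exists>h. h \<in> H \<and> A = F - {h} \<and> A' = F - {h} \<and> B = F \<and> B' = F))"
  proof (cases "A \<union> A' = F")
    case True
    then have refl: "R - f \<in> F" if "f \<in> F" for f using R that by blast
    have "R = r" using refl[OF r(1)] n0[of "R - r"] r(2)[OF R(1)] by (cases "R < r") auto
    have "r = m - 1"
    proof (rule ccontr)
      assume "r \<noteq> m - 1"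
      then have rl: "r \<le> m - 2" using rm1 by simp
      have "\<exists>f\<in>F. 1 \<le> f \<and> f \<le> m - 2 \<and> f \<notin> H"
      proof (rule ccontr)
        assume "\<not> ?thesis"
        then have "f0 \<in> H" "r \<in> H" using f0 f0b rl r by auto
        then show False using H1 f0(3) by blast
      qed
      then have "r - 2 \<in> F" using s2 \<open>R = r\<close> by blast
      then have two: "2 \<in> F" using refl \<open>R = r\<close> by force
      have "r \<noteq> 2"
      proof
        assume "r = 2"
        then have "f0 = 1" using f0b by simp
        then have "fold_mem m F (2 + 1)" using d2[of 2 1] two f0 by auto
        then show False using rl nr[of 3] nr[of "2 * m - 1 - (2 + 1)"] \<open>r = 2\<close> by (auto simp: fold_mem_def split: if_splits)
      qed
      then have "fold_mem m F (r + 2)" using d2[OF r(1) two] by auto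
      then show False using rl nr[of "r + 2"] nr[of "2 * m - 1 - (r + 2)"] by (auto simp: fold_mem_def split: if_splits)
    qed
    then show ?thesis using refl by blast
  next
    case False
    then obtain h where h: "h \<in> F" "h \<notin> A" "h \<notin> A'" using AB by blast
    have hH: "h \<in> H" using h unfolding H_def by auto
    have eq: "A = F - {h}" "A' = F - {h}" "B = F" "B' = F"
      using h AB bad(1)[OF h(1)] bad(2)[OF h(1)] by blast+
    have "r = m - 1"
      by (rule fold_top[OF F r(1) _ r(2)])
         (use f0b d2 r f0 c7[of r r] eq in auto)
    then show ?thesis using eq hH by blast
  qed
  then have rm: "r = m - 1" by blast
  \<comment> \<open>The sum \<open>(m - 1) + f\<close> reflects to \<open>m - f\<close>.\<close>
  have star: "m - f \<in> F" if "f \<in> F" "0 < f" "f < m - 1" for f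
    using d2[OF r(1) that(1)] that rm by (auto simp: fold_mem_def split: if_splits)
  have full: "F = {0..<m}" if one: "1 \<in> F" and t: "1 \<notin> H \<or> 2 \<in> F"
  proof (rule up_closed_full[OF F one z])
    fix f assume f: "f \<in> F" "1 \<le> f" "f + 1 < m"
    show "f + 1 \<in> F"
    proof (cases "f = 1 \<and> 1 \<in> H")
      case True
      then show ?thesis using t by auto
    next
      case False
      then show ?thesis using d2[OF f(1) one] f by (auto simp: fold_mem_def split: if_splits)
    qed
  qed
  have fullF: "F = {0..<m}"
  proof (cases "r \<in> H")
    case False
    have one: "1 \<in> F" using d2[OF r(1) r(1)] False rm m3 by (auto simp: fold_mem_def split: if_splits)
    show ?thesis
    proof (rule full[OF one], rule ccontr)
      assume "\<not> (1 \<notin> H \<or> 2 \<in> F)"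
      then have c: "1 \<in> H" "2 \<notin> F" by auto
      have m4: "m > 3"  using c rm r(1) m3 by (cases "m = 3") auto
      from top show False
      proof (elim conjE disjE exE)
        assume refl: "\<forall>f\<in>F. R - f \<in> F"
        then have "R = r" using refl r(1) n0[of "R - r"] r(2)[OF R(1)] by (cases "R < r") auto
        then have "m - 2 \<in> F" using refl one rm by force
        then show False using star[of "m - 2"] c m4 by auto
      next
        fix h assume "B = F" "B' = F"
        then show False using c7[of 1 1] one c m4 by (auto simp: fold_mem_def split: if_splits)
      qed
    qed
  next
    case True
    have g1: "1 \<notin> H" using H1[OF True, of 1] rm m3 by linarith
    have "1 \<in> F"
    proof (rule ccontr)
      assume n1: "1 \<notin> F"
      have m4: "m > 3"
      proof (rule ccontr)
        assume "\<not> m > 3"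
        then have "f0 = 1" using f0b rm m3 by simp
        then show False using n1 f0(1) by simp
      qed
      from top show False
      proof (elim conjE disjE exE)
        assume refl: "\<forall>f\<in>F. R - f \<in> F"
        then have "R = r" using refl r(1) n0[of "R - r"] r(2)[OF R(1)] by (cases "R < r") auto
        \<comment> \<open>With \<open>R = m - 1\<close> the reflections \<open>m - f\<close> and
          \<open>R - f\<close> compose to a step down by one; the descent ends at
          \<open>1\<close>.\<close>
        have dn: "f - 1 \<in> F" if "f \<in> F" "0 < f" "f < m - 1" for f
        proof -
          have "R - (m - f) \<in> F" using refl star[OF that] by blast
          then show ?thesis using \<open>R = r\<close> rm by (simp add: algebra_simps)
        qed
        have "\<forall>f. f \<in> F \<longrightarrow> 0 < f \<longrightarrow> f < m - 1 \<longrightarrow> nat f = n \<longrightarrow> 1 \<in> F" for n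
        proof (induction n)
          case (Suc n)
          show ?case
          proof (intro allI impI)
            fix f assume f: "f \<in> F" "0 < f" "f < m - 1" "nat f = Suc n"
            show "1 \<in> F" using Suc dn[OF f(1-3)] f by (cases "f = 1") auto
          qed
        qed auto
        then show False using f0 f0b n1 rm by auto
      next
        fix h assume hh: "h \<in> H" "A = F - {h}" "A' = F - {h}" "B = F" "B' = F"
        have hr: "h = r" using H1[OF hh(1) True] .
        have g: "R - f \<in> F" if "f \<in> F" "f < m - 1" for f using R(2)[of f] hh hr rm that by auto
        have f0m: "f0 < m - 1" using f0b rm by simp
        have "f0 \<noteq> 1" using n1 f0 by auto
        then have st0: "m - f0 \<in> F" "m - f0 \<le> m - 2" "f0 \<le> m - 2" using star[OF f0(1)] f0b f0m by auto
        \<comment> \<open>The two elements add up to \<open>m\<close>, and the fold with parameter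
          \<open>m - 1\<close> sends \<open>m\<close> to \<open>m - 3\<close>.\<close>
        have m3F: "m - 3 \<in> F" using c7[of f0 "m - f0"] hh st0 f0 by (auto simp: fold_mem_def split: if_splits)
        then have thF: "3 \<in> F" using star[of "m - 3"] m4 by auto
        have Rge: "R \<ge> m - 3" using g[OF m3F] n0[of "R - (m - 3)"] by force
        have R2: "R - 2 \<in> F" using s2[OF f0(1)] f0b f0m st0 H1[OF True, of f0] f0(3) by force
        have "m \<noteq> 4" using m3F n1 by auto
        have "R \<le> m - 1" using r(2)[OF R(1)] rm by simp
        then consider "R = m - 1" | "R = m - 2" | "R = m - 3" using Rge by linarith
        then show False
        proof cases
          case 1
          then have "2 \<in> F" using g[OF m3F] by auto
          then have "m - 2 \<in> F" using star[of 2] m4 by auto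
          then show False using g[of "m - 2"] 1 n1 by auto
        next
          case 2
          have "R - (m - 3) \<in> F" using g[OF m3F] by simp
          then show False using 2 n1 by simp
        next
          case 3
          \<comment> \<open>Now the two reflections compose to a step down by three, which would
            lead from \<open>2\<close> to \<open>-1\<close>.\<close>
          have m3s: "f - 3 \<in> F" if "f \<in> F" "0 < f" "f < m - 1" for f
            using g[OF star[OF that]] that 3 n1 by (cases "f = 1") (auto simp: algebra_simps)
          have m5: "m - 5 \<in> F" using R2 3 by auto
          then have "m \<ge> 5" using F by force
          have "m \<noteq> 6" using m5 n1 by auto
          show False
          proof (cases "m = 5")
            case True
            then have "2 \<in> F" using m3F by auto
            then show False using m3s[of 2] True n0[of "-1"] by auto
          next
            case False
            then have "5 \<in> F" using star[OF m5] \<open>m \<ge> 5\<close> by auto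
            then have "2 \<in> F" using m3s[of 5] \<open>m \<ge> 5\<close> False \<open>m \<noteq> 6\<close> by auto
            then show False using m3s[of 2] \<open>m \<ge> 5\<close> n0[of "-1"] by auto
          qed
        qed
      qed
    qed
    then show ?thesis using full g1 by blast
  qed
  have "R = m - 1"
  proof -
    have "R \<le> m - 1" using r(2)[OF R(1)] rm by simp
    moreover have "R \<ge> m - 1"
      using top
    proof (elim conjE disjE exE)
      assume "\<forall>f\<in>F. R - f \<in> F"
      then show ?thesis using r(1) rm n0[of "R - r"] by force
    next
      fix h assume hh: "h \<in> H" "A = F - {h}" "A' = F - {h}" "B = F" "B' = F"
      show ?thesis
      proof (cases "h = 1")
        case True
        then have "R - (m - 1) \<in> F" using R(2)[of "m - 1"] hh r(1) rm m3 by auto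
        then show ?thesis using n0 by force
      next
        case False
        then have "1 \<in> A" "m - 2 \<in> B'" using hh fullF m3 by auto
        then show ?thesis using c5(1)[of 1 "m - 2"] n0[of "R - 1 - \<bar>m - 2\<bar>"] m3 by force
      qed
    qed
    ultimately show ?thesis by simp
  qed
  then show ?thesis using fullF by blast
qed

section \<open>Paths, cycles and odd ears\<close>

locale ugraph =
  fixes V :: "'a set" and E :: "'a \<Rightarrow> 'a \<Rightarrow> bool"
  assumes finite_V: "finite V"
    and E_sym: "E u v \<Longrightarrow> E v u"
    and E_irrefl: "\<not> E u u"
    and E_V: "E u v \<Longrightarrow> u \<in> V"
begin

lemma E_V2: "E u v \<Longrightarrow> v \<in> V"
  using E_V E_sym by blast

definition upath :: "'a list \<Rightarrow> bool" where
  "upath p \<longleftrightarrow> distinct p \<and> set p \<subseteq> V \<and> successively E p"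

definition ucycle :: "'a list \<Rightarrow> bool" where
  "ucycle p \<longleftrightarrow> 3 \<le> length p \<and> distinct p \<and> successively E p \<and> E (last p) (hd p)"

definition odd_lengths :: "nat set" where
  "odd_lengths = {l. odd l \<and> (\<exists>p. ucycle p \<and> length p = l)}"

lemma successively_flip [simp]: "successively (\<lambda>u v. E v u) p \<longleftrightarrow> successively E p"
  by (rule successively_cong) (auto intro: E_sym)

lemma successively_rev_E: "successively E (rev p) \<longleftrightarrow> successively E p"
  by simp

lemma set_in_V:
  assumes "successively E p" "2 \<le> length p" shows "set p \<subseteq> V"
proof
  fix u assume "u \<in> set p"
  then obtain i where i: "i < length p" "u = p ! i" by (metis in_set_conv_nth)
  show "u \<in> V"
  proof (cases "Suc i < length p")
    case True
    then have "E (p ! i) (p ! Suc i)" using assms(1) by (simp add: successively_conv_nth)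
    then show ?thesis using E_V i by simp
  next
    case False
    then obtain j where j: "i = Suc j" using assms(2) i by (cases i) auto
    then have "E (p ! j) (p ! i)" using assms(1) i by (simp add: successively_conv_nth)
    then show ?thesis using E_V2 i by simp
  qed
qed

lemma finite_odd_lengths: "finite odd_lengths"
proof (rule finite_subset)
  show "odd_lengths \<subseteq> {..card V}"
  proof
    fix l assume "l \<in> odd_lengths"
    then obtain p where p: "ucycle p" "length p = l" unfolding odd_lengths_def by auto
    then have "set p \<subseteq> V" using set_in_V unfolding ucycle_def by auto
    then have "card (set p) \<le> card V" using finite_V by (rule card_mono[rotated])
    then show "l \<in> {..card V}" using p distinct_card unfolding ucycle_def by force
  qed
qed auto

text \<open>
  The ear has \<open>length q + 1\<close> edges; it is odd if this contradicts the colours of its ends.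
\<close>

definition odd_ear :: "'a set \<Rightarrow> ('a \<Rightarrow> bool) \<Rightarrow> bool" where
  "odd_ear C c \<longleftrightarrow> (\<exists>u v q. u \<in> C \<and> v \<in> C \<and> u \<noteq> v \<and> upath (u # q @ [v]) \<and> set q \<inter> C = {} \<and>
    (c u = c v \<longleftrightarrow> even (length q)))"

text \<open>The list has one vertex more than the path has edges; hence equal colours at the ends go
  with an odd length.\<close>

definition leg :: "'a set \<Rightarrow> ('a \<Rightarrow> bool) \<Rightarrow> 'a set \<Rightarrow> 'a \<Rightarrow> 'a list \<Rightarrow> bool" where
  "leg C c W u p \<longleftrightarrow> p \<noteq> [] \<and> hd p = u \<and> last p \<in> C \<and> set (butlast p) \<inter> C = {} \<and> set p \<subseteq> W \<and>
    distinct p \<and> successively E p \<and> (c (last p) = c u \<longleftrightarrow> odd (length p))"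

lemma legD:
  assumes "leg C c W u p"
  shows "p \<noteq> []" "hd p = u" "last p \<in> C" "set (butlast p) \<inter> C = {}" "set p \<subseteq> W"
    "distinct p" "successively E p" "c (last p) = c u \<longleftrightarrow> odd (length p)"
  using assms unfolding leg_def by simp_all

text \<open>The disjoint legs prolong the middle path to an ear of \<open>C\<close>. They respect
  the colours, so the violation on the middle path carries over to the new ends.\<close>

lemma odd_ear_join:
  assumes p: "leg C c W u p" and p': "leg C c W v p'" and disj: "set p \<inter> set p' = {}"
    and W: "C \<subseteq> W" "W \<subseteq> V"
    and mid: "upath (u # mid @ [v])" "set mid \<inter> W = {}" and par: "c u = c v \<longleftrightarrow> even (length mid)"
  shows "odd_ear C c"
proof -
  define q where "q = rev (butlast p) @ mid @ butlast p'"
  note D = legD[OF p] and D' = legD[OF p']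
  note ne = D(1) D'(1) D(2) D'(2) and dp = D(6) D'(6) D(5) D'(5)
  have dm: "distinct mid" "set mid \<subseteq> V" using mid(1) unfolding upath_def by simp_all
  have r1: "last p # rev (butlast p) = rev p"
    using ne(1) by (metis append_butlast_last_id rev_append rev.simps append_Nil append_Cons)
  have r2: "butlast p' @ [last p'] = p'" using ne(2) by simp
  have "last p # q @ [last p'] = (last p # rev (butlast p)) @ mid @ (butlast p' @ [last p'])"
    unfolding q_def by (simp only: append_Cons append_assoc)
  then have eq: "last p # q @ [last p'] = rev p @ mid @ p'"
    unfolding r1 r2 .
  have "distinct (rev p @ mid @ p')"
    unfolding distinct_append set_append set_rev distinct_rev using dp dm disj mid(2) by blast
  moreover have "set (rev p @ mid @ p') \<subseteq> V"
    unfolding set_append set_rev using dp dm W by blast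
  moreover have "successively E (rev p @ mid @ p')"
  proof -
    have sp: "successively E (rev p)" "successively E p'"
      using D(7) D'(7) by simp_all
    have sm: "successively E (u # mid @ [v])" using mid(1) unfolding upath_def by blast
    have lr: "last (rev p) = u" using ne by (simp add: last_rev)
    show ?thesis
    proof (cases "mid = []")
      case True
      then show ?thesis using sp sm lr ne by (simp add: successively_append_iff)
    next
      case False
      then have "E u (hd mid)" "successively E mid" "E (last mid) v"
        using sm by (simp_all add: successively_append_iff successively_Cons)
      then show ?thesis using sp lr ne False by (simp add: successively_append_iff)
    qed
  qed
  ultimately have 1: "upath (last p # q @ [last p'])" unfolding eq upath_def by blast
  have 2: "set q \<inter> C = {}" using D(4) D'(4) mid(2) W(1) unfolding q_def by auto
  have "last p \<in> set p" "last p' \<in> set p'" using ne by simp_all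
  then have 3: "last p \<noteq> last p'" using disj by fastforce
  obtain a b where ab: "length p = Suc a" "length p' = Suc b"
    using ne(1,2) by (metis Suc_pred length_greater_0_conv)
  have l: "length q = a + length mid + b" unfolding q_def using ab by simp
  have "even a \<longleftrightarrow> c (last p) = c u" "even b \<longleftrightarrow> c (last p') = c v"
    using D(8) D'(8) ab by simp_all
  then have "c (last p) = c (last p') \<longleftrightarrow> even (length q)" using par unfolding l even_add by blast
  then show ?thesis unfolding odd_ear_def using 1 2 3 D(3) D'(3) by blast
qed

text \<open>
  Any two vertices of \<open>W\<close> reach \<open>C\<close> along disjoint paths that respect the colouring. This is
  preserved when a properly coloured ear is added, whereas an edge or ear that violates the
  colouring extends to an odd ear of \<open>C\<close>. So a maximal such \<open>W\<close> yields an odd ear or a bipartition.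
\<close>

definition fan :: "'a set \<Rightarrow> ('a \<Rightarrow> bool) \<Rightarrow> 'a set \<Rightarrow> bool" where
  "fan C c W \<longleftrightarrow> C \<subseteq> W \<and> W \<subseteq> V \<and> (\<forall>u\<in>W. \<forall>v\<in>W. u \<noteq> v \<longrightarrow>
    (\<exists>p p'. leg C c W u p \<and> leg C c W v p' \<and> set p \<inter> set p' = {}))"

lemma leg_cong:
  assumes "leg C c W u p" "W \<subseteq> W'" "\<And>w. w \<in> W \<Longrightarrow> c' w = c w" "C \<subseteq> W"
  shows "leg C c' W' u p"
proof -
  note D = legD[OF assms(1)]
  have "u \<in> W" using D(1,2,5) by (metis hd_in_set subsetD)
  moreover have "last p \<in> W" using D(3) assms(4) by auto
  ultimately show ?thesis using D assms(2,3) unfolding leg_def by simp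
qed

text \<open>The new vertices are coloured alternately along \<open>mid\<close>, and each can leave
  through \<open>u\<close> or through \<open>v\<close>. Of two new vertices the earlier takes
  \<open>u\<close> and the later \<open>v\<close>; against an old vertex \<open>b\<close> the exit
  is \<open>u\<close> unless \<open>b = u\<close>.\<close>

lemma fan_extend:
  assumes fan: "fan C c W" and uv: "u \<in> W" "v \<in> W" "u \<noteq> v"
    and mid: "upath (u # mid @ [v])" "set mid \<inter> W = {}" and par: "c u = c v \<longleftrightarrow> odd (length mid)"
  shows "\<exists>c'. fan C c' (W \<union> set mid) \<and> (\<forall>w\<in>W. c' w = c w)"
proof -
  define W' where "W' = W \<union> set mid"
  define c' where "c' w = (if w \<in> set mid then (c u \<longleftrightarrow> odd (THE i. i < length mid \<and> mid ! i = w)) else c w)" for w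
  have d: "distinct mid" using mid unfolding upath_def by auto
  have CW: "C \<subseteq> W" "W \<subseteq> V" using fan unfolding fan_def by auto
  have cW: "c' w = c w" if "w \<in> W" for w using that mid(2) unfolding c'_def by auto
  have cmid: "c' (mid ! i) \<longleftrightarrow> (c u \<longleftrightarrow> odd i)" if "i < length mid" for i
  proof -
    have "(THE j. j < length mid \<and> mid ! j = mid ! i) = i"
      using d that by (intro the_equality) (auto simp: nth_eq_iff_index_eq)
    then show ?thesis using that unfolding c'_def by auto
  qed
  have lc: "leg C c' W' w p" if "leg C c W w p" for w p
    using leg_cong[OF that, of W' c'] cW CW unfolding W'_def by auto
  have suc: "successively E (u # mid @ [v])" using mid unfolding upath_def by auto
  have left: "leg C c' W' (mid ! i) (rev (take (Suc i) mid) @ p)" if "leg C c W u p" "i < length mid" for i p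
  proof -
    note p = legD[OF that(1)]
    have t: "take (Suc i) mid = take i mid @ [mid ! i]" using that by (simp add: take_Suc_conv_app_nth)
    have h: "hd (rev (take (Suc i) mid) @ p) = mid ! i" unfolding t by simp
    have "successively E (u # take (Suc i) mid @ drop (Suc i) mid @ [v])" using suc
      by (metis append_assoc append_take_drop_id)
    then have s1: "successively E (u # take (Suc i) mid)"
      using successively_append_iff[of E "u # take (Suc i) mid"] by simp
    then have s2: "successively E (rev (take (Suc i) mid) @ [u])"
      using successively_rev_E[of "u # take (Suc i) mid"] by simp
    have s3: "successively E (rev (take (Suc i) mid) @ p)"
      using s2 p(1,2,7) by (simp add: successively_append_iff)
    have mm: "set (take (Suc i) mid) \<subseteq> set mid" by (rule set_take_subset)
    have len: "length (take (Suc i) mid) = Suc i" using that by simp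
    have "c' (last p) = c (last p)" using cW p CW by auto
    then have "c' (last p) = c' (mid ! i) \<longleftrightarrow> odd (Suc i + length p)"
      using p(8) cmid[OF that(2)] by auto
    then have par': "c' (last p) = c' (mid ! i) \<longleftrightarrow> odd (length (rev (take (Suc i) mid) @ p))"
      using len by simp
    have dd: "distinct (rev (take (Suc i) mid) @ p)"
      unfolding distinct_append set_rev distinct_rev using p(5,6) mm mid(2) d by auto
    have cc: "set (butlast (rev (take (Suc i) mid) @ p)) \<inter> C = {}"
      using p(1,4) mm mid(2) CW by (auto simp: butlast_append)
    show ?thesis unfolding leg_def
      using p(1,3,5) h s3 mm dd cc par' unfolding W'_def by auto
  qed
  have right: "leg C c' W' (mid ! i) (drop i mid @ p)" if "leg C c W v p" "i < length mid" for i p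
  proof -
    note p = legD[OF that(1)]
    have h: "hd (drop i mid @ p) = mid ! i" using that by (simp add: hd_drop_conv_nth)
    have "successively E ((u # take i mid) @ drop i mid @ [v])" using suc
      by (metis append_Cons append_assoc append_take_drop_id)
    then have s1: "successively E (drop i mid @ [v])"
      using successively_append_iff by blast
    have s3: "successively E (drop i mid @ p)"
      using s1 p(1,2,7) by (simp add: successively_append_iff)
    have mm: "set (drop i mid) \<subseteq> set mid" by (rule set_drop_subset)
    have "c' (last p) = c (last p)" using cW p CW by auto
    moreover have "odd (length mid - i) \<longleftrightarrow> (odd (length mid) \<longleftrightarrow> even i)" using that by auto
    ultimately have "c' (last p) = c' (mid ! i) \<longleftrightarrow> odd (length mid - i + length p)"
      using p(8) cmid[OF that(2)] par by auto
    then have par': "c' (last p) = c' (mid ! i) \<longleftrightarrow> odd (length (drop i mid @ p))"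
      by simp
    have dd: "distinct (drop i mid @ p)"
      unfolding distinct_append using p(5,6) mm mid(2) d by auto
    have cc: "set (butlast (drop i mid @ p)) \<inter> C = {}"
      using p(1,4) mm mid(2) CW by (auto simp: butlast_append)
    show ?thesis unfolding leg_def
      using p(1,3,5) h s3 mm dd cc par' unfolding W'_def by auto
  qed
  have fW: "\<exists>p p'. leg C c W a p \<and> leg C c W b p' \<and> set p \<inter> set p' = {}" if "a \<in> W" "b \<in> W" "a \<noteq> b" for a b
    using fan that unfolding fan_def by blast
  have sub: "set p \<subseteq> W" if "leg C c W a p" for a p using legD(5)[OF that] .
  have mixed: "\<exists>p p'. leg C c' W' (mid ! i) p \<and> leg C c' W' b p' \<and> set p \<inter> set p' = {}"
    if i: "i < length mid" and b: "b \<in> W" for i b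
  proof (cases "b = u")
    case False
    then obtain p p' where pp: "leg C c W u p" "leg C c W b p'" "set p \<inter> set p' = {}"
      using fW[of u b] uv b by auto
    have "set (rev (take (Suc i) mid) @ p) \<inter> set p' = {}"
      using pp(3) sub[OF pp(2)] mid(2) set_take_subset[of "Suc i" mid] by auto
    then show ?thesis using left[OF pp(1) i] lc[OF pp(2)] by blast
  next
    case True
    obtain p p' where pp: "leg C c W v p" "leg C c W b p'" "set p \<inter> set p' = {}"
      using fW[of v b] uv b True by auto
    have "set (drop i mid @ p) \<inter> set p' = {}"
      using pp(3) sub[OF pp(2)] mid(2) set_drop_subset[of i mid] by auto
    then show ?thesis using right[OF pp(1) i] lc[OF pp(2)] by blast
  qed
  have both: "\<exists>p p'. leg C c' W' (mid ! i) p \<and> leg C c' W' (mid ! j) p' \<and> set p \<inter> set p' = {}"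
    if ij: "i < j" "j < length mid" for i j
  proof -
    obtain p p' where pp: "leg C c W u p" "leg C c W v p'" "set p \<inter> set p' = {}"
      using fW[OF uv] by blast
    have "set (take (Suc i) mid) \<inter> set (drop j mid) = {}"
      using set_take_disj_set_drop_if_distinct[OF d, of "Suc i" j] ij by simp
    then have "set (rev (take (Suc i) mid) @ p) \<inter> set (drop j mid @ p') = {}"
      using pp(3) sub[OF pp(2)] sub[OF pp(1)] mid(2) set_take_subset[of "Suc i" mid] set_drop_subset[of j mid]
      by fastforce
    then show ?thesis using left[OF pp(1), of i] right[OF pp(2) ij(2)] ij by fastforce
  qed
  have "fan C c' W'"
    unfolding fan_def
  proof (intro conjI ballI impI)
    show "C \<subseteq> W'" "W' \<subseteq> V" using CW mid unfolding W'_def upath_def by auto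
    fix a b assume ab: "a \<in> W'" "b \<in> W'" "a \<noteq> b"
    have idx: "\<exists>i<length mid. w = mid ! i" if "w \<in> W'" "w \<notin> W" for w
      using that unfolding W'_def by (metis UnE in_set_conv_nth)
    consider "a \<in> W" "b \<in> W" | "a \<in> W" "b \<notin> W" | "a \<notin> W" "b \<in> W" | "a \<notin> W" "b \<notin> W" by blast
    then show "\<exists>p p'. leg C c' W' a p \<and> leg C c' W' b p' \<and> set p \<inter> set p' = {}"
    proof cases
      case 1 then show ?thesis using fW[OF _ _ ab(3)] lc by blast
    next
      case 2 then show ?thesis using mixed idx[OF ab(2)] by (metis Int_commute)
    next
      case 3 then show ?thesis using mixed idx[OF ab(1)] by blast
    next
      case 4
      then obtain i j where ij: "i < length mid" "a = mid ! i" "j < length mid" "b = mid ! j"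
        using idx ab by blast
      then have "i < j \<or> j < i" using ab(3) by (metis nat_neq_iff)
      then show ?thesis using both ij by (metis Int_commute)
    qed
  qed
  then show ?thesis using cW unfolding W'_def by blast
qed

end

section \<open>Odd ears in 2-connected non-bipartite graphs\<close>

locale two_connected_graph = ugraph +
  assumes no_cut_vertex: "W \<subseteq> V - {z} \<Longrightarrow> W \<noteq> {} \<Longrightarrow> V - {z} - W \<noteq> {} \<Longrightarrow> \<exists>u\<in>W. \<exists>v\<in>V - {z} - W. E u v"
    and connected: "W \<subseteq> V \<Longrightarrow> W \<noteq> {} \<Longrightarrow> V - W \<noteq> {} \<Longrightarrow> \<exists>u\<in>W. \<exists>v\<in>V - W. E u v"
begin

text \<open>Leave \<open>W\<close> by an edge from \<open>u\<close> to \<open>w\<close>. The part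
  outside \<open>W\<close> reachable from \<open>w\<close> has an edge to a vertex of
  \<open>W\<close> other than \<open>u\<close>, since \<open>u\<close> is not a cut vertex.\<close>

lemma ear_exists:
  assumes W: "W \<subseteq> V" "W \<noteq> V" "a \<in> W" "b \<in> W" "a \<noteq> b"
  shows "\<exists>u v mid. u \<in> W \<and> v \<in> W \<and> u \<noteq> v \<and> mid \<noteq> [] \<and> upath (u # mid @ [v]) \<and> set mid \<inter> W = {}"
proof -
  obtain u w where uw: "u \<in> W" "w \<in> V" "w \<notin> W" "E u w"
    using connected[of W] W by blast
  define Z where "Z = {z. \<exists>p. p \<noteq> [] \<and> upath p \<and> set p \<inter> W = {} \<and> hd p = w \<and> last p = z}"
  have wZ: "w \<in> Z" unfolding Z_def using uw by (auto intro!: exI[of _ "[w]"] simp: upath_def)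
  have ZV: "Z \<subseteq> V - W"
  proof
    fix z assume "z \<in> Z"
    then obtain p where "p \<noteq> []" "upath p" "set p \<inter> W = {}" "last p = z" unfolding Z_def by blast
    then show "z \<in> V - W" unfolding upath_def using last_in_set[of p] by blast
  qed
  have "V - {u} - Z \<noteq> {}" using W ZV uw by (cases "a = u") auto
  then obtain z v where zv: "z \<in> Z" "v \<in> V - {u} - Z" "E z v"
    using no_cut_vertex[of Z u] wZ ZV uw(1) by blast
  obtain p where p: "p \<noteq> []" "upath p" "set p \<inter> W = {}" "hd p = w" "last p = z"
    using zv(1) unfolding Z_def by blast
  have "v \<in> W"
  proof (rule ccontr)
    assume vW: "v \<notin> W"
    have ex: "v \<in> Z" if "q \<noteq> []" "upath q" "set q \<inter> W = {}" "hd q = w" "last q = v" for q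
      unfolding Z_def using that by blast
    have "v \<in> Z"
    proof (cases "v \<in> set p")
      case False
      show ?thesis
        by (rule ex[of "p @ [v]"]) (use p zv vW False in \<open>simp_all add: upath_def successively_append_iff\<close>)
    next
      case True
      then obtain p1 p2 where s: "p = p1 @ v # p2" by (meson split_list)
      then have ps: "p = (p1 @ [v]) @ p2" by simp
      have "upath (p1 @ [v])"
        using p(2) unfolding ps upath_def successively_append_iff[of _ "p1 @ [v]" p2] by simp
      moreover have "hd (p1 @ [v]) = w" using p(4) s by (cases p1) simp_all
      moreover have "set (p1 @ [v]) \<inter> W = {}" using p(3) s by auto
      ultimately show ?thesis using ex[of "p1 @ [v]"] by simp
    qed
    then show False using zv by blast
  qed
  moreover have "upath (u # p @ [v])"
    using p uw zv \<open>v \<in> W\<close> W(1) by (auto simp: upath_def successively_append_iff successively_Cons)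
  ultimately show ?thesis using uw p zv by blast
qed

lemma odd_ear_exists:
  assumes C: "C \<subseteq> V" "a \<in> C" "b \<in> C" "a \<noteq> b" and nb: "\<And>c' :: 'a \<Rightarrow> bool. \<exists>u v. E u v \<and> c' u = c' v"
  shows "odd_ear C c"
proof (rule ccontr)
  assume no: "\<not> odd_ear C c"
  define P where "P W \<longleftrightarrow> (\<exists>c'. fan C c' W \<and> (\<forall>w\<in>C. c' w = c w))" for W
  have ext: "odd_ear C c" if eq: "\<forall>w\<in>C. c' w = c w" and ear: "odd_ear C c'" for c'
  proof -
    obtain u v q where h: "u \<in> C" "v \<in> C" "u \<noteq> v" "upath (u # q @ [v])" "set q \<inter> C = {}"
      "c' u = c' v \<longleftrightarrow> even (length q)" using ear unfolding odd_ear_def by blast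
    then have "c u = c v \<longleftrightarrow> even (length q)" using eq by simp
    then show ?thesis unfolding odd_ear_def using h by blast
  qed
  have "fan C c C"
    unfolding fan_def
  proof (intro conjI ballI impI)
    fix u v assume "u \<in> C" "v \<in> C" "u \<noteq> v"
    then show "\<exists>p p'. leg C c C u p \<and> leg C c C v p' \<and> set p \<inter> set p' = {}"
      by (intro exI[of _ "[u]"] exI[of _ "[v]"]) (auto simp: leg_def)
  qed (use C in auto)
  then have PC: "P C" unfolding P_def by blast
  have "P W \<Longrightarrow> card W < Suc (card V)" for W
    unfolding P_def fan_def using card_mono[OF finite_V] le_imp_less_Suc by blast
  then obtain W where W: "P W" "\<And>W'. P W' \<Longrightarrow> card W' \<le> card W"
    using ex_has_greatest_nat[of P C card "Suc (card V)"] PC by blast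
  obtain c' where c': "fan C c' W" "\<forall>w\<in>C. c' w = c w" using W(1) unfolding P_def by blast
  have CW: "C \<subseteq> W" "W \<subseteq> V" using c' unfolding fan_def by auto
  have fW: "\<exists>p p'. leg C c' W u p \<and> leg C c' W v p' \<and> set p \<inter> set p' = {}"
    if "u \<in> W" "v \<in> W" "u \<noteq> v" for u v
    using c'(1) that unfolding fan_def by blast
  have good: "c' u = c' v \<longleftrightarrow> odd (length mid)"
    if m: "u \<in> W" "v \<in> W" "u \<noteq> v" "upath (u # mid @ [v])" "set mid \<inter> W = {}" for u v mid
  proof (rule ccontr)
    assume "\<not> ?thesis"
    then have par: "c' u = c' v \<longleftrightarrow> even (length mid)" by blast
    obtain p p' where "leg C c' W u p" "leg C c' W v p'" "set p \<inter> set p' = {}" using fW[OF m(1-3)] by blast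
    from odd_ear_join[OF this CW m(4,5) par] show False using ext[OF c'(2)] no by blast
  qed
  show False
  proof (cases "W = V")
    case True
    \<comment> \<open>For \<open>W = V\<close> a monochromatic edge acts as an ear without inner
      vertices.\<close>
    obtain u v where "E u v" "c' u = c' v" using nb[of c'] by blast
    moreover then have "u \<in> W" "v \<in> W" "u \<noteq> v" "upath (u # [] @ [v])"
      using True E_V E_V2 E_irrefl by (auto simp: upath_def)
    ultimately show False using good[of u v "[]"] by auto
  next
    case False
    have "a \<in> W" "b \<in> W" using C CW by auto
    from ear_exists[OF CW(2) False this C(4)] obtain u v mid where
      m: "u \<in> W" "v \<in> W" "u \<noteq> v" "mid \<noteq> []" "upath (u # mid @ [v])" "set mid \<inter> W = {}" by blast
    from fan_extend[OF c'(1) m(1-3,5,6) good[OF m(1-3,5,6)]] have "P (W \<union> set mid)"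
      unfolding P_def using c'(2) CW by fastforce
    then have "card (W \<union> set mid) \<le> card W" using W(2) by blast
    moreover have "W \<subset> W \<union> set mid" using m(4,6) by (cases mid) auto
    moreover have "finite (W \<union> set mid)" using CW finite_V finite_subset by auto
    ultimately show False using psubset_card_mono by (metis leD)
  qed
qed

end

section \<open>Cycles along an indexed path\<close>

definition seg :: "nat \<Rightarrow> nat \<Rightarrow> nat list" where
  "seg s t = (if s \<le> t then [s..<Suc t] else rev [t..<Suc s])"

lemma seg_simps [simp]:
  "seg s t \<noteq> []" "hd (seg s t) = s" "last (seg s t) = t" "distinct (seg s t)"
  "length (seg s t) = (t - s) + (s - t) + 1" "set (seg s t) = {min s t..max s t}"
  by (auto simp: seg_def hd_rev last_rev simp del: upt_Suc)

context ugraph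
begin

definition idx_path :: "(nat \<Rightarrow> 'a) \<Rightarrow> nat \<Rightarrow> bool" where
  "idx_path x N \<longleftrightarrow> inj_on x {..N} \<and> (\<forall>i<N. E (x i) (x (Suc i)))"

abbreviation idx_walk :: "(nat \<Rightarrow> 'a) \<Rightarrow> nat list \<Rightarrow> bool" where
  "idx_walk x p \<equiv> successively (\<lambda>i j. E (x i) (x j)) p"

lemma idx_walk_rev: "idx_walk x (rev p) \<longleftrightarrow> idx_walk x p"
  unfolding successively_rev by (rule successively_cong) (auto intro: E_sym)

lemma idx_walk_seg:
  assumes "idx_path x N" "s \<le> N" "t \<le> N"
  shows "idx_walk x (seg s t)"
proof -
  have up: "idx_walk x [a..<b]" if "b \<le> Suc N" for a b
    using assms(1) that unfolding idx_path_def by (auto simp: successively_conv_nth)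
  have "idx_walk x (rev [a..<b])" if "b \<le> Suc N" for a b
    using up[OF that] unfolding idx_walk_rev .
  then show ?thesis using up[of "Suc t" s] assms by (simp add: seg_def del: upt_Suc)
qed

lemma idx_cycle:
  assumes x: "inj_on x {..N}" and l: "odd l" "l = length p" "3 \<le> l"
    and d: "distinct p" "set p \<subseteq> {..N}" and w: "idx_walk x p" and c: "E (x (last p)) (x (hd p))"
  shows "l \<in> odd_lengths"
proof -
  have ne: "p \<noteq> []" using l by auto
  have "distinct (map x p)" using d x by (auto simp: distinct_map intro: inj_on_subset)
  moreover have "successively E (map x p)" using w by (simp add: successively_map)
  moreover have "E (last (map x p)) (hd (map x p))" using c ne by (simp add: last_map hd_map)
  ultimately have "ucycle (map x p)" unfolding ucycle_def using l by simp
  then show ?thesis unfolding odd_lengths_def using l by (auto intro!: exI[of _ "map x p"])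
qed

text \<open>This turns a longest path into another one on the same vertices with a different
  start.\<close>

lemma idx_path_reorder:
  assumes x: "idx_path x N" and d: "distinct p" "set p = {..N}" and w: "idx_walk x p"
  shows "idx_path (\<lambda>i. x (p ! i)) N"
  unfolding idx_path_def
proof (intro conjI allI impI)
  have l: "length p = Suc N" using distinct_card[OF d(1)] d(2) by simp
  have "inj_on ((!) p) {..N}" using d(1) l by (auto simp: inj_on_def nth_eq_iff_index_eq)
  moreover have "((!) p) ` {..N} = {..N}"
    using l d(2) by (auto simp: set_conv_nth image_def less_Suc_eq_le)
  ultimately show "inj_on (\<lambda>i. x (p ! i)) {..N}"
    using x comp_inj_on[of "(!) p" "{..N}" x] unfolding idx_path_def comp_def by simp
  show "E (x (p ! i)) (x (p ! Suc i))" if "i < N" for i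
    using w l that by (simp add: successively_conv_nth)
qed

lemma idx_pathD:
  assumes "idx_path x N"
  shows "inj_on x {..N}" "\<And>i. Suc i \<le> N \<Longrightarrow> E (x i) (x (Suc i))"
    "\<And>i. 0 < i \<Longrightarrow> i \<le> N \<Longrightarrow> E (x (i - Suc 0)) (x i)"
proof -
  show "inj_on x {..N}" and st: "\<And>i. Suc i \<le> N \<Longrightarrow> E (x i) (x (Suc i))"
    using assms unfolding idx_path_def by auto
  show "E (x (i - Suc 0)) (x i)" if "0 < i" "i \<le> N" for i using st[of "i - 1"] that by simp
qed

lemma idx_path_cong:
  assumes "idx_path x N" "\<And>i. i \<le> N \<Longrightarrow> x' i = x i"
  shows "idx_path x' N"
proof -
  have "inj_on x' {..N}" using idx_pathD(1)[OF assms(1)] assms(2) by (simp add: inj_on_def)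
  moreover have "E (x' i) (x' (Suc i))" if "i < N" for i
    using idx_pathD(2)[OF assms(1), of i] assms(2)[of i] assms(2)[of "Suc i"] that by simp
  ultimately show ?thesis unfolding idx_path_def by blast
qed

lemmas walk_simps = successively_append_iff successively_Cons hd_append last_append

lemma chord_cycle:
  assumes x: "idx_path x N" and s: "E (x 0) (x s)" and t: "E (x 0) (x t)"
    and i: "0 < s" "s < t" "t \<le> N" and l: "odd l" and eq: "l = t - s + 2"
  shows "l \<in> odd_lengths"
  by (rule idx_cycle[OF idx_pathD(1)[OF x] l, where p = "0 # seg s t"])
     (use s E_sym[OF t] i eq in \<open>auto simp: walk_simps idx_walk_seg[OF x]\<close>)

text \<open>The chords start at the two neighbours \<open>x 0\<close> and \<open>x (e - 1)\<close>
  of \<open>x e\<close>, and \<open>x e\<close> closes the cycle between them.\<close>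

lemma twin_chord_cycle:
  assumes x: "idx_path x N" and e: "E (x 0) (x e)" "e \<le> N"
    and s: "E (x 0) (x s)" and t: "E (x (e - 1)) (x t)" and i: "0 < s" "s + 2 \<le> e" "0 < t" "t + 2 \<le> e"
    and l: "odd l" and eq: "l = (t - s) + (s - t) + 4"
  shows "l \<in> odd_lengths"
  by (rule idx_cycle[OF idx_pathD(1)[OF x] l, where p = "0 # seg s t @ [e - 1, e]"])
     (use E_sym[OF e(1)] e(2) s E_sym[OF t] i eq in \<open>auto simp: walk_simps idx_walk_seg[OF x] idx_pathD(3)[OF x]\<close>)

text \<open>The return from \<open>x (e - 1)\<close> to \<open>x 0\<close> runs along the tail up to
  \<open>x o'\<close> instead of through \<open>x e\<close> alone.\<close>

lemma tail_chord_cycle: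
  assumes x: "idx_path x N" and e: "e < o'" "o' \<le> N"
    and o: "E (x 0) (x o')"
    and s: "E (x 0) (x s)" and t: "E (x (e - 1)) (x t)" and i: "0 < s" "s + 2 \<le> e" "0 < t" "t + 2 \<le> e"
    and l: "odd l" and eq: "l = (t - s) + (s - t) + 4 + (o' - e)"
  shows "l \<in> odd_lengths"
  by (rule idx_cycle[OF idx_pathD(1)[OF x] l, where p = "0 # seg s t @ (e - 1) # seg e o'"])
     (use E_sym[OF o] e s E_sym[OF t] i eq in \<open>auto simp: walk_simps idx_walk_seg[OF x] idx_pathD(3)[OF x]\<close>)

lemma tail_chord_cycle':
  assumes x: "idx_path x N" and e: "e < o'" "o' \<le> N" and e0: "E (x 0) (x e)"
    and o: "E (x (e - 1)) (x o')"
    and s: "E (x 0) (x s)" and t: "E (x (e - 1)) (x t)" and i: "0 < s" "s + 2 \<le> e" "0 < t" "t + 2 \<le> e"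
    and l: "odd l" and eq: "l = (t - s) + (s - t) + 4 + (o' - e)"
  shows "l \<in> odd_lengths"
  by (rule idx_cycle[OF idx_pathD(1)[OF x] l, where p = "0 # seg s t @ (e - 1) # seg o' e"])
     (use E_sym[OF e0] o e s E_sym[OF t] i eq in \<open>auto simp: walk_simps idx_walk_seg[OF x]\<close>)

text \<open>All of \<open>x 0\<close>, ..., \<open>x (e - 1)\<close> is used and closed by a stretch
  of the tail, so the length exceeds \<open>e + 1\<close>.\<close>

lemma long_cycle:
  assumes x: "idx_path x N" and e: "0 < e" "e < a" "a \<le> N" "e < b" "b \<le> N" "a \<noteq> b"
    and o: "E (x 0) (x a)" "E (x (e - 1)) (x b)"
    and l: "odd l" and eq: "l = (a - b) + (b - a) + 1 + e"
  shows "l \<in> odd_lengths"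
  by (rule idx_cycle[OF idx_pathD(1)[OF x] l, where p = "seg 0 (e - 1) @ seg b a"])
     (use E_sym[OF o(1)] o(2) e eq in \<open>auto simp: walk_simps idx_walk_seg[OF x]\<close>)

text \<open>This is a Posa rotation: the chord to \<open>x s\<close> replaces the edge from
  \<open>x (s - 1)\<close> to \<open>x s\<close>, and \<open>x (s - 1)\<close> becomes the
  start.\<close>

lemma idx_path_rotate:
  assumes x: "idx_path x N" and s: "E (x 0) (x s)" "0 < s" "s \<le> N"
  shows "idx_path (\<lambda>i. if i < s then x (s - 1 - i) else x i) N"
proof -
  define p where "p = seg (s - 1) 0 @ seg s N"
  have nth: "p ! i = (if i < s then s - 1 - i else i)" if "i \<le> N" for i
    using s that unfolding p_def seg_def by (auto simp: nth_append rev_nth simp del: upt_Suc)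
  have "idx_path (\<lambda>i. x (p ! i)) N"
    by (rule idx_path_reorder[OF x])
       (use s in \<open>auto simp: p_def walk_simps idx_walk_seg[OF x]\<close>)
  then show ?thesis by (rule idx_path_cong) (simp add: nth)
qed

definition longest_path :: "(nat \<Rightarrow> 'a) \<Rightarrow> nat \<Rightarrow> bool" where
  "longest_path x N \<longleftrightarrow> idx_path x N \<and> (\<forall>p. upath p \<longrightarrow> length p \<le> Suc N)"

lemma longest_path_neighbours:
  assumes lp: "longest_path x N" and N: "0 < N" and w: "E (x 0) w"
  shows "\<exists>i\<le>N. 0 < i \<and> w = x i"
proof -
  have "w \<in> x ` {..N}"
  proof (rule ccontr)
    assume n: "w \<notin> x ` {..N}"
    have path: "idx_path x N" using lp unfolding longest_path_def by blast
    have ws: "successively E (map x [0..<Suc N])"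
      using idx_walk_seg[OF path, of 0 N] by (simp add: seg_def successively_map del: upt_Suc)
    have ln: "2 \<le> length (map x [0..<Suc N])" using N by simp
    have d: "distinct (map x [0..<Suc N])"
      unfolding distinct_map using idx_pathD(1)[OF path] by (simp add: lessThan_Suc_atMost atLeast0LessThan del: upt_Suc)
    have "hd (map x [0..<Suc N]) = x 0" by (simp add: hd_map del: upt_Suc)
    then have "upath (w # map x [0..<Suc N])"
      unfolding upath_def using ws set_in_V[OF ws ln] d E_V2[OF w] E_sym[OF w] n
      by (simp add: successively_Cons lessThan_Suc_atMost atLeast0LessThan del: upt_Suc)
    then have "length (w # map x [0..<Suc N]) \<le> Suc N" using lp unfolding longest_path_def by blast
    then show False by simp
  qed
  then obtain i where i: "i \<le> N" "w = x i" by blast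
  then have "i \<noteq> 0" using w E_irrefl by metis
  then show ?thesis using i by blast
qed

end

section \<open>Chords at the ends of an odd cycle with a tail\<close>

text \<open>The numbers of elements that \<open>A\<close> and \<open>B\<close> lack add up to at
  most one.\<close>

lemma almost_full:
  assumes "finite F" "A \<subseteq> F" "B \<subseteq> F" "2 * card F \<le> card A + card B + 1"
  shows "A \<union> B = F" "\<And>f g. f \<in> F \<Longrightarrow> g \<in> F \<Longrightarrow> f \<notin> A \<inter> B \<Longrightarrow> g \<notin> A \<inter> B \<Longrightarrow> f = g"
proof -
  have fin: "finite A" "finite B" using assms finite_subset by blast+
  have "card (F - A) + card A = card F" "card (F - B) + card B = card F"
    using assms(1-3) card_mono[of F] by (simp_all add: card_Diff_subset fin)
  then have le: "card (F - A) + card (F - B) \<le> 1" using assms(4) by linarith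
  have "(F - A) \<inter> (F - B) = {}"
  proof (rule ccontr)
    assume "(F - A) \<inter> (F - B) \<noteq> {}"
    then have "card (F - A) > 0" "card (F - B) > 0" using assms(1) by (auto simp: card_gt_0_iff)
    then show False using le by simp
  qed
  then show "A \<union> B = F" using assms by blast
  have "card ((F - A) \<union> (F - B)) \<le> 1" using card_Un_le[of "F - A" "F - B"] le by linarith
  then show "f = g" if "f \<in> F" "g \<in> F" "f \<notin> A \<inter> B" "g \<notin> A \<inter> B" for f g
    using that assms(1) card_le_Suc0_iff_eq[of "(F - A) \<union> (F - B)"] by auto
qed

lemma all_full:
  assumes "finite F" "A \<subseteq> F" "B \<subseteq> F" "2 * card F \<le> card A + card B"
  shows "A = F" "B = F"
proof -
  have "card A \<le> card F" "card B \<le> card F" using assms card_mono by auto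
  then have "card A = card F" "card B = card F" using assms(4) by auto
  then show "A = F" "B = F" using assms card_subset_eq by blast+
qed

context ugraph
begin

text \<open>
  On the odd cycle \<open>x 0, \<dots>, x (2 * m)\<close> the chords from \<open>x 0\<close> to \<open>x (2 * m - 2 * f)\<close> and to
  \<open>x (2 * f + 1)\<close> both cut off an odd cycle of length \<open>2 * m + 1 - 2 * f\<close>.
\<close>

definition even_chords :: "(nat \<Rightarrow> 'a) \<Rightarrow> nat \<Rightarrow> int set" where
  "even_chords x m = int ` {f. f < m \<and> E (x 0) (x (2 * m - 2 * f))}"

definition odd_chords :: "(nat \<Rightarrow> 'a) \<Rightarrow> nat \<Rightarrow> int set" where
  "odd_chords x m = int ` {f. f < m \<and> E (x 0) (x (2 * f + 1))}"

definition tail_chords :: "(nat \<Rightarrow> 'a) \<Rightarrow> nat \<Rightarrow> nat \<Rightarrow> nat set" where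
  "tail_chords x m N = {t. 2 * m < t \<and> t \<le> N \<and> E (x 0) (x t)}"

text \<open>
  The code \<open>h\<close> stands for the length \<open>2 * m + 1 - 2 * h\<close>; negative codes are lengths beyond that
  of the cycle \<open>x 0, \<dots>, x (2 * m)\<close>.
\<close>

definition codes :: "nat \<Rightarrow> int set" where
  "codes m = {h. \<exists>l\<in>odd_lengths. int l = 2 * int m + 1 - 2 * h}"

text \<open>
  Exchanges the two neighbours \<open>x 0\<close> and \<open>x (2 * m - 1)\<close> of \<open>x (2 * m)\<close> on the cycle.
\<close>

definition flip :: "nat \<Rightarrow> (nat \<Rightarrow> 'a) \<Rightarrow> nat \<Rightarrow> 'a" where
  "flip m x i = (if i < 2 * m then x (2 * m - 1 - i) else x i)"

lemma odd_lengths_ge3: "l \<in> odd_lengths \<Longrightarrow> 3 \<le> l \<and> odd l"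
  unfolding odd_lengths_def ucycle_def by auto

lemma codesI: "l \<in> odd_lengths \<Longrightarrow> int l = 2 * int m + 1 - 2 * h \<Longrightarrow> h \<in> codes m"
  unfolding codes_def by blast

lemma codes_le: "h \<in> codes m \<Longrightarrow> h < int m"
  unfolding codes_def using odd_lengths_ge3 by fastforce

lemma card_codes: "finite (codes m)" "card (codes m) \<le> card odd_lengths"
proof -
  have "codes m \<subseteq> (\<lambda>l. (2 * int m + 1 - int l) div 2) ` odd_lengths"
  proof
    fix h assume "h \<in> codes m"
    then obtain l where l: "l \<in> odd_lengths" "int l = 2 * int m + 1 - 2 * h" unfolding codes_def by blast
    then have "h = (2 * int m + 1 - int l) div 2" by simp
    then show "h \<in> (\<lambda>l. (2 * int m + 1 - int l) div 2) ` odd_lengths" using l(1) by blast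
  qed
  then show "finite (codes m)" "card (codes m) \<le> card odd_lengths"
    using finite_surj[OF finite_odd_lengths] surj_card_le[OF finite_odd_lengths] by blast+
qed

lemma mem_codes_length:
  assumes "l \<in> odd_lengths" shows "(2 * int m + 1 - int l) div 2 \<in> codes m"
proof (rule codesI[OF assms])
  have "odd (int l)" using odd_lengths_ge3[OF assms] by simp
  then show "int l = 2 * int m + 1 - 2 * ((2 * int m + 1 - int l) div 2)" by presburger
qed

end

section \<open>Extremal configurations and the odd cycles formed by their chords\<close>

locale few_odd_cycles = two_connected_graph +
  fixes k :: nat
  assumes k3: "3 \<le> k"
    and degree: "v \<in> V \<Longrightarrow> 2 * k \<le> card {u. E v u}"
    and few: "card odd_lengths \<le> k"

text \<open>The assumption \<open>extremal\<close> ranges over all longest paths, so that rotated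
  and reordered paths give configurations with the same \<open>m\<close>.\<close>

locale even_config = few_odd_cycles +
  fixes x :: "nat \<Rightarrow> 'a" and N m :: nat
  assumes lp: "longest_path x N"
    and m: "0 < m" "2 * m \<le> N"
    and close: "E (x 0) (x (2 * m))"
    and extremal: "longest_path x' N \<Longrightarrow> s \<le> N \<Longrightarrow> even s \<Longrightarrow> E (x' 0) (x' s) \<Longrightarrow> s \<le> 2 * m"
begin

lemma path: "idx_path x N"
  using lp unfolding longest_path_def by blast

lemma longest_rotate:
  assumes "E (x 0) (x s)" "0 < s" "s \<le> N"
  shows "longest_path (\<lambda>i. if i < s then x (s - 1 - i) else x i) N"
  using idx_path_rotate[OF path assms] lp unfolding longest_path_def by blast

abbreviation "y \<equiv> flip m x"

text \<open>The flip is the rotation along the closing chord. Every result about the start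
  \<open>x 0\<close> thereby becomes available for \<open>x (2 * m - 1)\<close>.\<close>

lemma config_flip: "even_config V E k y N m"
proof unfold_locales
  show "longest_path y N"
    using longest_rotate[OF close] m unfolding flip_def[abs_def] by simp
  show "E (y 0) (y (2 * m))"
    using idx_pathD(3)[OF path, of "2 * m"] m unfolding flip_def by simp
qed (use m extremal in auto)

lemma zero_chords: "0 \<in> even_chords x m" "0 \<in> odd_chords x m"
  using close m idx_pathD(2)[OF path, of 0] unfolding even_chords_def odd_chords_def by auto

lemma chord_count: "2 * k \<le> card (even_chords x m) + card (odd_chords x m) + card (tail_chords x m N)"
proof -
  let ?A = "{f. f < m \<and> E (x 0) (x (2 * m - 2 * f))}" and ?B = "{f. f < m \<and> E (x 0) (x (2 * f + 1))}"
  have fin: "finite ?A" "finite ?B" "finite (tail_chords x m N)" unfolding tail_chords_def by auto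
  have "{u. E (x 0) u} \<subseteq> (\<lambda>f. x (2 * m - 2 * f)) ` ?A \<union> (\<lambda>f. x (2 * f + 1)) ` ?B \<union> x ` tail_chords x m N"
  proof
    fix u assume "u \<in> {u. E (x 0) u}"
    then obtain i where i: "u = x i" "i \<le> N" "E (x 0) (x i)" and "i \<noteq> 0"
      using longest_path_neighbours[OF lp] m by auto
    show "u \<in> (\<lambda>f. x (2 * m - 2 * f)) ` ?A \<union> (\<lambda>f. x (2 * f + 1)) ` ?B \<union> x ` tail_chords x m N"
    proof (cases "2 * m < i")
      case True
      then show ?thesis using i unfolding tail_chords_def by blast
    next
      case False
      show ?thesis
      proof (cases "even i")
        case True
        then obtain j where j: "i = 2 * j" by (elim evenE)
        have "2 * m - 2 * (m - j) = i" "m - j < m" using False j \<open>i \<noteq> 0\<close> by auto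
        then show ?thesis using i by (intro UnI1) (auto intro!: image_eqI[of _ _ "m - j"])
      next
        case odd: False
        then obtain j where j: "i = 2 * j + 1" by (elim oddE)
        have "j < m" using False j by auto
        then show ?thesis using i j by (intro UnI1 UnI2) (auto intro!: image_eqI[of _ _ j])
      qed
    qed
  qed
  then have "card {u. E (x 0) u} \<le> card ((\<lambda>f. x (2 * m - 2 * f)) ` ?A \<union> (\<lambda>f. x (2 * f + 1)) ` ?B \<union> x ` tail_chords x m N)"
    using fin by (intro card_mono) auto
  also have "\<dots> \<le> card ((\<lambda>f. x (2 * m - 2 * f)) ` ?A \<union> (\<lambda>f. x (2 * f + 1)) ` ?B) + card (x ` tail_chords x m N)"
    by (rule card_Un_le)
  also have "\<dots> \<le> card ((\<lambda>f. x (2 * m - 2 * f)) ` ?A) + card ((\<lambda>f. x (2 * f + 1)) ` ?B) + card (x ` tail_chords x m N)"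
    using card_Un_le by simp
  also have "\<dots> \<le> card ?A + card ?B + card (tail_chords x m N)"
    using fin card_image_le by (intro add_mono) blast+
  also have "card ?A = card (even_chords x m)" unfolding even_chords_def by (simp add: card_image)
  also have "card ?B = card (odd_chords x m)" unfolding odd_chords_def by (simp add: card_image)
  finally show ?thesis using degree[OF E_V[OF close]] by linarith
qed

text \<open>These are the lengths up to that of the cycle; the other elements of
  \<open>codes m\<close> are negative and stand for longer cycles.\<close>

definition F :: "int set" where
  "F = {h \<in> codes m. 0 \<le> h}"

lemma F_bounds: "F \<subseteq> {0..<int m}" "finite F"
  unfolding F_def using codes_le card_codes by auto

lemma tail_odd: "t \<in> tail_chords x m N \<Longrightarrow> odd t"
  using extremal[OF lp] unfolding tail_chords_def by fastforce

lemma FI: "l \<in> odd_lengths \<Longrightarrow> int l = 2 * int m + 1 - 2 * h \<Longrightarrow> 0 \<le> h \<Longrightarrow> h \<in> F"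
  unfolding F_def using codesI by blast

text \<open>The stretch between the two chord ends is closed through \<open>x 0\<close>. The
  reflected value occurs when the odd end lies beyond the even one.\<close>

lemma chord_sum:
  assumes "f \<in> even_chords x m" "g \<in> odd_chords x m"
  shows "fold_mem (int m) F (f + g)"
proof -
  obtain a where a: "f = int a" "a < m" "E (x 0) (x (2 * m - 2 * a))"
    using assms unfolding even_chords_def by blast
  obtain b where b: "g = int b" "b < m" "E (x 0) (x (2 * b + 1))"
    using assms unfolding odd_chords_def by blast
  show ?thesis
  proof (cases "a + b < m")
    case True
    have "2 * m + 1 - 2 * (a + b) \<in> odd_lengths"
      by (rule chord_cycle[OF path b(3) a(3)]) (use True a b m in auto)
    then have "f + g \<in> F" by (rule FI) (use True a b in auto)
    then show ?thesis using True a b unfolding fold_mem_def by auto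
  next
    case False
    have "2 * (a + b) + 3 - 2 * m \<in> odd_lengths"
      by (rule chord_cycle[OF path a(3) b(3)]) (use False a b m in auto)
    then have "2 * int m - 1 - (f + g) \<in> F" by (rule FI) (use False a b in auto)
    then show ?thesis using False a b unfolding fold_mem_def by auto
  qed
qed

lemma chords_F: "even_chords x m \<subseteq> F" "odd_chords x m \<subseteq> F"
proof -
  show "even_chords x m \<subseteq> F"
  proof
    fix f assume f: "f \<in> even_chords x m"
    then have "f < int m" unfolding even_chords_def by auto
    then show "f \<in> F" using chord_sum[OF f zero_chords(2)] unfolding fold_mem_def by simp
  qed
  show "odd_chords x m \<subseteq> F"
  proof
    fix f assume f: "f \<in> odd_chords x m"
    then have "f < int m" unfolding odd_chords_def by auto
    then show "f \<in> F" using chord_sum[OF zero_chords(1) f] unfolding fold_mem_def by simp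
  qed
qed

lemma flip_odd_chord:
  assumes "g \<in> odd_chords y m" "g \<le> int m - 2"
  obtains b where "g = int b" "b + 2 \<le> m" "E (x (2 * m - 1)) (x (2 * m - 2 - 2 * b))"
proof -
  obtain b where b: "g = int b" "b < m" "E (y 0) (y (2 * b + 1))"
    using assms unfolding odd_chords_def by blast
  then have "b + 2 \<le> m" using assms by simp
  then have "y 0 = x (2 * m - 1)" "y (2 * b + 1) = x (2 * m - 2 - 2 * b)"
    using m unfolding flip_def by (auto intro!: arg_cong[of _ _ x])
  then show thesis using that[OF b(1) \<open>b + 2 \<le> m\<close>] b(3) by simp
qed

text \<open>The chord ends are \<open>2 * a + 1\<close> and \<open>2 * m - 2 - 2 * b\<close>. In the
  reverse order the cycle has length \<open>2 * (a + b) + 7 - 2 * m\<close>, whose code is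
  \<open>2 * m - 3 - (a + b)\<close>; hence the parameter \<open>m - 1\<close>.\<close>

lemma twin_sum:
  assumes "f \<in> odd_chords x m" "g \<in> odd_chords y m" "f \<le> int m - 2" "g \<le> int m - 2"
  shows "fold_mem (int m - 1) F (f + g)"
proof -
  obtain a where a: "f = int a" "a < m" "E (x 0) (x (2 * a + 1))"
    using assms unfolding odd_chords_def by blast
  obtain b where b: "g = int b" "b + 2 \<le> m" "E (x (2 * m - 1)) (x (2 * m - 2 - 2 * b))"
    using flip_odd_chord assms by blast
  have a2: "a + 2 \<le> m" using a assms by simp
  show ?thesis
  proof (cases "a + b + 1 < m")
    case True
    have "2 * m + 1 - 2 * (a + b) \<in> odd_lengths"
      by (rule twin_chord_cycle[OF path close m(2) a(3) b(3)]) (use True a2 b in auto)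
    then have "f + g \<in> F" by (rule FI) (use True a b in auto)
    then show ?thesis using True a b unfolding fold_mem_def by auto
  next
    case False
    have "2 * (a + b) + 7 - 2 * m \<in> odd_lengths"
      by (rule twin_chord_cycle[OF path close m(2) a(3) b(3)]) (use False a2 b in auto)
    then have "2 * int m - 3 - (f + g) \<in> F" by (rule FI) (use False a2 a b in auto)
    then show ?thesis using False a b unfolding fold_mem_def by auto
  qed
qed

text \<open>\<open>R\<close> is the code of the cycle that consists of \<open>x 0\<close> and the
  stretch from \<open>x (2 * m)\<close> to \<open>x t\<close>. Tail chords are described by this
  number from here on.\<close>

lemma tail_reflect0:
  assumes "t \<in> tail_chords x m N" "int t = 4 * int m - 1 - 2 * R"
  shows "R \<in> codes m"
proof -
  have t: "2 * m < t" "t \<le> N" "E (x 0) (x t)" using assms unfolding tail_chords_def by auto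
  have "t - 2 * m + 2 \<in> odd_lengths"
    by (rule chord_cycle[OF path close t(3)]) (use m t tail_odd[OF assms(1)] in auto)
  then show ?thesis by (rule codesI) (use assms t in auto)
qed

text \<open>The cycle uses the tail up to \<open>x t\<close>, one chord at each of
  \<open>x 0\<close> and \<open>x (2 * m - 1)\<close>, and the stretch between the ends of these
  chords, which has \<open>2 * \<bar>g + 1 - f\<bar>\<close> edges.\<close>

lemma tail_reflect:
  assumes t: "t \<in> tail_chords x m N \<union> tail_chords y m N" and R: "int t = 4 * int m - 1 - 2 * R"
    and f: "f \<in> even_chords x m" "1 \<le> f" and g: "g \<in> odd_chords y m" "g \<le> int m - 2"
  shows "R - 1 - \<bar>g + 1 - f\<bar> \<in> codes m"
proof -
  obtain a where a: "f = int a" "a < m" "E (x 0) (x (2 * m - 2 * a))"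
    using f unfolding even_chords_def by blast
  obtain b where b: "g = int b" "b + 2 \<le> m" "E (x (2 * m - 1)) (x (2 * m - 2 - 2 * b))"
    using flip_odd_chord g by blast
  define c e where "c = m - a" and "e = m - 1 - b"
  have ce: "0 < c" "c < m" "0 < e" "e < m" "int c = int m - f" "int e = int m - 1 - g"
    using a b f unfolding c_def e_def by auto
  have s: "E (x 0) (x (2 * c))" and r: "E (x (2 * m - 1)) (x (2 * e))"
    using a(3) b(3) unfolding c_def e_def by (simp_all add: diff_mult_distrib2)
  define d where "d = (2 * e - 2 * c) + (2 * c - 2 * e)"
  have d: "int d = 2 * \<bar>g + 1 - f\<bar>"
  proof (cases "c \<le> e")
    case True
    then have "int d = 2 * int e - 2 * int c" "int c \<le> int e" unfolding d_def by simp_all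
    moreover from this have "\<bar>g + 1 - f\<bar> = f - (g + 1)" using ce(5,6) by simp
    ultimately show ?thesis using ce(5,6) by simp
  next
    case False
    then have "int d = 2 * int c - 2 * int e" "int e < int c" unfolding d_def by simp_all
    moreover from this have "\<bar>g + 1 - f\<bar> = g + 1 - f" using ce(5,6) by simp
    ultimately show ?thesis using ce(5,6) by simp
  qed
  then have de: "even d" by presburger
  have "odd t" using R by presburger
  have t2: "2 * m < t" "t \<le> N" using t unfolding tail_chords_def by auto
  have lo: "odd (d + 4 + (t - 2 * m))" using de \<open>odd t\<close> t2 by simp
  have i: "0 < 2 * c" "2 * c + 2 \<le> 2 * m" "0 < 2 * e" "2 * e + 2 \<le> 2 * m" using ce by simp_all
  have "d + 4 + (t - 2 * m) \<in> odd_lengths"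
  proof (cases "t \<in> tail_chords x m N")
    case True
    then have "E (x 0) (x t)" unfolding tail_chords_def by blast
    from tail_chord_cycle[OF path t2 this s r i lo] show ?thesis unfolding d_def by simp
  next
    case False
    then have "E (y 0) (y t)" using t unfolding tail_chords_def by blast
    then have "E (x (2 * m - 1)) (x t)" using t2 m unfolding flip_def by simp
    from tail_chord_cycle'[OF path t2 close this s r i lo] show ?thesis unfolding d_def by simp
  qed
  moreover have "int (d + 4 + (t - 2 * m)) = 2 * int m + 1 - 2 * (R - 1 - \<bar>g + 1 - f\<bar>)"
    using d t2 R by (simp add: of_nat_diff)
  ultimately show ?thesis by (rule codesI)
qed

text \<open>The code is negative: the two tail chords and all of \<open>x 0\<close>, ...,
  \<open>x (2 * m - 1)\<close> lie on a cycle longer than \<open>2 * m + 1\<close>.\<close>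

lemma long_code:
  assumes "s \<in> tail_chords x m N" "t \<in> tail_chords y m N" "s \<noteq> t" "2 * h = - \<bar>int s - int t\<bar>"
  shows "h \<in> codes m"
proof -
  have s: "2 * m < s" "s \<le> N" "E (x 0) (x s)" using assms unfolding tail_chords_def by auto
  have t: "2 * m < t" "t \<le> N" "E (y 0) (y t)" using assms unfolding tail_chords_def by auto
  have t': "E (x (2 * m - 1)) (x t)" using t m unfolding flip_def by simp
  have ev: "even (int ((s - t) + (t - s)))"
  proof -
    have "int ((s - t) + (t - s)) = - 2 * h" using assms(4) by auto
    then show ?thesis by simp
  qed
  have "(s - t) + (t - s) + 1 + 2 * m \<in> odd_lengths"
    by (rule long_cycle[OF path _ s(1,2) t(1,2) assms(3) s(3) t']) (use m ev in auto)
  then show ?thesis by (rule codesI) (use assms(4) in auto)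
qed

end

context ugraph
begin

lemma flip_involution: "flip m (flip m x) = x"
  by (auto simp: flip_def fun_eq_iff)

end

context even_config
begin

interpretation flp: even_config V E k y N m
  by (rule config_flip)

abbreviation "ex \<equiv> even_chords x m"
abbreviation "ox \<equiv> odd_chords x m"
abbreviation "ey \<equiv> even_chords y m"
abbreviation "oy \<equiv> odd_chords y m"
abbreviation "tx \<equiv> tail_chords x m N"
abbreviation "ty \<equiv> tail_chords y m N"

lemma F_subset: "F \<subseteq> codes m"
  unfolding F_def by blast

lemma card_F_neg: "card F + card (codes m - F) \<le> k"
proof -
  have "card F + card (codes m - F) = card (codes m)"
    using F_subset card_codes(1) F_bounds(2)
    by (metis card_Diff_subset card_mono le_add_diff_inverse)
  then show ?thesis using card_codes(2)[of m] few by linarith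
qed

lemma card_chords: "card ex \<le> card F" "card ox \<le> card F"
  using chords_F F_bounds(2) card_mono by blast+

lemma card_F_le: "card F \<le> m"
  using card_mono[OF _ F_bounds(1)] by simp

lemma tail_finite: "finite tx"
  unfolding tail_chords_def by auto

lemma tail_even:
  assumes "t \<in> tx \<union> ty" shows "\<exists>R. int t = 4 * int m - 1 - 2 * R"
proof -
  have "odd t" using tail_odd flp.tail_odd assms by blast
  then have "int t = 4 * int m - 1 - 2 * ((4 * int m - 1 - int t) div 2)" by presburger
  then show ?thesis by blast
qed

text \<open>For \<open>f \<ge> 1\<close> the odd chord of code \<open>0\<close> at the opposite
  start reduces \<open>R - 1 - \<bar>g + 1 - f\<bar>\<close> to \<open>R - f\<close>.\<close>

lemma reflect:
  assumes t: "t \<in> tx \<union> ty" and R: "int t = 4 * int m - 1 - 2 * R" and m2: "2 \<le> m"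
    and f: "f \<in> ex \<or> f \<in> ey"
  shows "R - f \<in> codes m"
proof -
  have t': "t \<in> ty \<union> tail_chords (flip m y) m N" using t unfolding flip_involution by blast
  show ?thesis
  proof (cases "f = 0")
    case True
    then show ?thesis using tail_reflect0[OF _ R] flp.tail_reflect0[OF _ R] t by auto
  next
    case False
    have f1: "1 \<le> f" using f False unfolding even_chords_def by auto
    from f show ?thesis
    proof
      assume "f \<in> ex"
      from tail_reflect[OF t R this f1 flp.zero_chords(2)] show ?thesis using m2 f1 by simp
    next
      assume fy: "f \<in> ey"
      have "0 \<in> odd_chords (flip m y) m" unfolding flip_involution by (rule zero_chords(2))
      from flp.tail_reflect[OF t' R fy f1 this] show ?thesis using m2 f1 by simp
    qed
  qed
qed

lemma full_if_all_chords:
  assumes "ex = F" "ox = F" "oy = F" "2 \<le> card F"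
  shows "F = {0..<int m}"
proof (rule fold_closed_full[OF F_bounds(2,1) assms(4)])
  show "0 \<in> F" using zero_chords(1) assms(1) by blast
  show "fold_mem (int m) F (f + g)" if "f \<in> F" "g \<in> F" for f g
    using chord_sum that assms by blast
  show "fold_mem (int m - 1) F (f + g)" if "f \<in> F" "g \<in> F" "f \<le> int m - 2" "g \<le> int m - 2" for f g
    using twin_sum that assms by blast
qed

lemma full_if_almost_all_chords:
  assumes cF: "codes m = F" "card F = k" and c: "2 * k \<le> card ex + card ox + 1" "2 * k \<le> card ey + card oy + 1"
    and t: "t \<in> tx \<union> ty"
  shows "F = {0..<int m} \<and> t = 2 * m + 1"
proof -
  obtain R where R: "int t = 4 * int m - 1 - 2 * R" using tail_even[OF t] by blast
  have m2: "2 \<le> m" using card_F_le cF k3 by linarith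
  have t': "t \<in> ty \<union> tail_chords (flip m y) m N" using t unfolding flip_involution by blast
  have sub: "ex \<subseteq> F" "ox \<subseteq> F" "ey \<subseteq> F" "oy \<subseteq> F" using chords_F flp.chords_F by blast+
  have ax: "2 * card F \<le> card ex + card ox + 1" and ay: "2 * card F \<le> card ey + card oy + 1" using c cF by auto
  note afx = almost_full[OF F_bounds(2) sub(1,2) ax] and afy = almost_full[OF F_bounds(2) sub(3,4) ay]
  have z: "0 \<in> F" using zero_chords(1) sub(1) by blast
  have zx: "0 \<in> ex" using zero_chords by blast
  have "F = {0..<int m} \<and> R = int m - 1"
  proof (rule fold_almost_closed_full[OF F_bounds(2,1) _ z afx(1) afy(1) afx(2) afy(2)])
    show "3 \<le> card F" using cF k3 by simp
    show "fold_mem (int m) F (f + g)" if "f \<in> ex" "g \<in> ox" for f g using chord_sum that by blast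
    show "fold_mem (int m) F (f + g)" if "f \<in> ey" "g \<in> oy" for f g using flp.chord_sum that by blast
    show "fold_mem (int m - 1) F (f + g)" if "f \<in> ox" "g \<in> oy" "f \<le> int m - 2" "g \<le> int m - 2" for f g
      using twin_sum that by blast
    show "R \<in> F" using reflect[OF t R m2, of 0] zx cF by simp
    show "R - f \<in> F" if "f \<in> ex" for f using reflect[OF t R m2] that cF by blast
    show "R - f \<in> F" if "f \<in> ey" for f using reflect[OF t R m2] that cF by blast
    show "R - 1 - \<bar>g + 1 - f\<bar> \<in> F" if "f \<in> ex" "1 \<le> f" "g \<in> oy" "g \<le> int m - 2" for f g
      using tail_reflect[OF t R that] cF by blast
    show "R - 1 - \<bar>g + 1 - f\<bar> \<in> F" if "f \<in> ey" "1 \<le> f" "g \<in> ox" "g \<le> int m - 2" for f g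
      using flp.tail_reflect[OF t' R that(1,2) _ that(4)] that(3) cF unfolding flip_involution by blast
  qed
  then show ?thesis using R by auto
qed

end

section \<open>Chords into the tail weighed against longer odd cycles\<close>

context even_config
begin

interpretation flp: even_config V E k y N m
  by (rule config_flip)

text \<open>At least \<open>2 * k\<close> chords are paired on at most \<open>k\<close> codes, so
  all counts are tight and no longer length remains. Two tail chords at the flipped start, with
  codes \<open>R\<close> and \<open>Q\<close>, would put both \<open>R - Q\<close> and
  \<open>Q - R\<close> into \<open>F\<close>; hence \<open>R = Q\<close>.\<close>

lemma no_tail:
  assumes "tx = {}"
  shows "ex = F" "ox = F" "card F = k" "codes m = F" "2 * k \<le> card ey + card oy + 1"
proof -
  have "2 * k \<le> card ex + card ox" using chord_count assms by simp
  then have 1: "card F = k" "card (codes m - F) = 0" using card_chords card_F_neg by linarith+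
  show "card F = k" by (rule 1)
  have "codes m - F = {}" using 1(2) card_codes(1)[of m] by (simp only: card_eq_0_iff finite_Diff simp_thms)
  then show cF: "codes m = F" using F_subset by blast
  have "2 * card F \<le> card ex + card ox" using \<open>2 * k \<le> card ex + card ox\<close> 1(1) by simp
  from all_full[OF F_bounds(2) chords_F this] show eq: "ex = F" "ox = F" .
  have m2: "2 \<le> m" using card_F_le 1 k3 by linarith
  have "s = t" if st: "s \<in> ty" "t \<in> ty" for s t
  proof -
    obtain R where R: "int s = 4 * int m - 1 - 2 * R" using tail_even st by blast
    obtain Q where Q: "int t = 4 * int m - 1 - 2 * Q" using tail_even st by blast
    have r: "R - f \<in> F" "Q - f \<in> F" if "f \<in> F" for f
      using reflect[OF UnI2[OF st(1)] R m2] reflect[OF UnI2[OF st(2)] Q m2] that unfolding cF eq(1) by blast+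
    have "0 \<in> F" using zero_chords(1) eq by blast
    then have "R \<in> F" "Q \<in> F" using r[of 0] by auto
    then have "R - Q \<in> F" "Q - R \<in> F" using r by auto
    then have "0 \<le> R - Q" "0 \<le> Q - R" using F_bounds(1) by auto
    then have "R = Q" by simp
    then show ?thesis using R Q by simp
  qed
  then have "card ty \<le> Suc 0" unfolding card_le_Suc0_iff_eq[OF flp.tail_finite] by blast
  then show "2 * k \<le> card ey + card oy + 1" using flp.chord_count by linarith
qed

text \<open>Every tail chord at the flipped start with an end other than \<open>s\<close> forms with
  the chord to \<open>x s\<close> a longer cycle, and different ends give different negative
  codes.\<close>

lemma min_tail:
  assumes s: "s \<in> tx" "\<And>t. t \<in> ty \<Longrightarrow> s \<le> t"
  shows "card (ty - {s}) \<le> card (codes m - F)"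
proof -
  define g where "g t = (int s - int t) div 2" for t
  have ev: "2 * g t = int s - int t" if "t \<in> ty" for t
  proof -
    have "odd s" "odd t" using tail_odd[OF s(1)] flp.tail_odd[OF that] .
    then show ?thesis unfolding g_def by presburger
  qed
  show ?thesis
  proof (rule card_inj_on_le[of g])
    show "inj_on g (ty - {s})"
    proof (rule inj_onI)
      fix a b assume "a \<in> ty - {s}" "b \<in> ty - {s}" "g a = g b"
      then show "a = b" using ev[of a] ev[of b] by force
    qed
    show "g ` (ty - {s}) \<subseteq> codes m - F"
    proof (rule image_subsetI)
      fix t assume t: "t \<in> ty - {s}"
      then have t': "t \<in> ty" "s \<noteq> t" by blast+
      then have lt: "s < t" using s(2)[of t] by linarith
      have e: "2 * g t = - \<bar>int s - int t\<bar>" using ev[OF t'(1)] lt by linarith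
      have "g t \<in> codes m" by (rule long_code[OF s(1) t' e])
      moreover have "g t < 0" using e lt by linarith
      ultimately show "g t \<in> codes m - F" unfolding F_def by simp
    qed
    show "finite (codes m - F)" using card_codes(1) by (rule finite_Diff)
  qed
qed

text \<open>If c codes are negative, then \<open>2 * k \<le> 2 * card F + card ty\<close>,
  \<open>card F\<close> + c \<le> \<open>k\<close> and \<open>card ty\<close> \<le> c + 1. Together
  these give c \<le> 1, and for c = 1 all three are equalities.\<close>

lemma min_tail_two:
  assumes s: "s \<in> tx" "\<And>t. t \<in> tx \<union> ty \<Longrightarrow> s \<le> t" and neg: "codes m \<noteq> F"
  shows "s \<in> ty \<and> card ty = 2 \<and> card (codes m - F) = 1 \<and> card F + 1 = k"
proof -
  have n: "card (codes m - F) \<ge> 1"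
  proof (rule ccontr)
    assume "\<not> ?thesis"
    then have "card (codes m - F) = 0" by linarith
    then have "codes m - F = {}" using card_codes(1)[of m] by (simp only: card_eq_0_iff finite_Diff simp_thms)
    then show False using F_subset neg by blast
  qed
  have b: "2 * k \<le> 2 * card F + card ty" using flp.chord_count flp.card_chords by linarith
  have d: "card (ty - {s}) \<le> card (codes m - F)" by (rule min_tail[OF s(1)]) (rule s(2)[OF UnI2])
  have "card ty \<le> card (ty - {s}) + 1"
    using card_Suc_Diff1[OF flp.tail_finite, of s] by (cases "s \<in> ty") simp_all
  then have *: "card ty = 2 \<and> card (codes m - F) = 1 \<and> card F + 1 = k"
    using n b d card_F_neg by linarith
  moreover have "s \<in> ty"
  proof (rule ccontr)
    assume "s \<notin> ty"
    then have "ty - {s} = ty" by blast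
    then have "card ty \<le> card (codes m - F)" using d by (simp only:)
    then show False using * by linarith
  qed
  ultimately show ?thesis by blast
qed

text \<open>
  The neighbours of \<open>z = x (2 * m + 2)\<close> provide a cycle through \<open>x 0, \<dots>, x (2 * m + 2)\<close>. Opened
  next to \<open>x 0\<close> and continued at \<open>x (2 * m + 3)\<close>, it is the initial part of a longest path whose
  start has a neighbour of index \<open>2 * m + 2\<close>.
\<close>

lemma two_tails_False:
  assumes full: "F = {0..<int m}" "ex = F" "ox = F" and m2: "2 \<le> m" and t: "2 * m + 1 \<in> tx" "2 * m + 3 \<in> tx"
    and le: "\<And>l. l \<in> odd_lengths \<Longrightarrow> l \<le> 2 * m + 3"
  shows False
proof -
  have N: "2 * m + 3 \<le> N" using t unfolding tail_chords_def by simp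
  have t': "E (x 0) (x (2 * m + 1))" "E (x 0) (x (2 * m + 3))" using t unfolding tail_chords_def by auto
  have adj: "E (x 0) (x i)" if i: "1 \<le> i" "i \<le> 2 * m + 1" for i
  proof (cases "i = 2 * m + 1")
    case True then show ?thesis using t' by simp
  next
    case False
    show ?thesis
    proof (cases "even i")
      case True
      then obtain j where j: "i = 2 * j" by (elim evenE)
      have "int (m - j) \<in> ex" using full j i by auto
      then have "E (x 0) (x (2 * m - 2 * (m - j)))" unfolding even_chords_def by auto
      moreover have "2 * m - 2 * (m - j) = i" using j i by auto
      ultimately show ?thesis by simp
    next
      case odd: False
      then obtain j where j: "i = 2 * j + 1" by (elim oddE)
      have "int j \<in> ox" using full j i False by auto
      then show ?thesis using j unfolding odd_chords_def by auto
    qed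
  qed
  define z where "z = x (2 * m + 2)"
  define x' where "x' i = (if i < 2 * m + 3 then x (2 * m + 3 - 1 - i) else x i)" for i
  have lx': "longest_path x' N" unfolding x'_def[abs_def] by (rule longest_rotate[OF t'(2)]) (use N in auto)
  have z0: "x' 0 = z" unfolding x'_def z_def by simp
  have N0: "0 < N" using N by simp
  \<comment> \<open>A neighbour farther out would close an odd cycle longer than
    \<open>2 * m + 3\<close>; for odd \<open>i\<close> the vertex \<open>x 1\<close> is left out to
    correct the parity.\<close>
  have nb: "\<exists>j \<le> 2 * m + 3. w = x j" if w: "E z w" for w
  proof -
    obtain i where i: "i \<le> N" "w = x' i" using longest_path_neighbours[OF lx' N0, of w] w z0 by auto
    show ?thesis
    proof (cases "i \<le> 2 * m + 3")
      case True
      show ?thesis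
      proof (cases "i < 2 * m + 3")
        case True then show ?thesis using i unfolding x'_def by (intro exI[of _ "2 * m + 3 - 1 - i"]) simp
      next
        case False then show ?thesis using i True unfolding x'_def by (intro exI[of _ i]) simp
      qed
    next
      case False
      then have w': "w = x i" using i unfolding x'_def by simp
      have ei: "E (x i) (x (2 * m + 2))" using E_sym[OF w] unfolding z_def w' .
      show ?thesis
      proof (cases "even i")
        case True
        then have lo: "odd (i + 1)" by simp
        have "i + 1 \<in> odd_lengths"
          by (rule idx_cycle[OF idx_pathD(1)[OF path] lo, where p = "seg (2 * m + 2) 0 @ seg (2 * m + 3) i"])
             (use ei t' i N False in \<open>auto simp: walk_simps idx_walk_seg[OF path]\<close>)
        then show ?thesis using le[of "i + 1"] False by simp
      next
        case odd: False
        have "i \<in> odd_lengths"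
          by (rule idx_cycle[OF idx_pathD(1)[OF path] odd, where p = "seg (2 * m + 2) 2 @ 0 # seg (2 * m + 3) i"])
             (use ei t' i N False E_sym[OF adj[of 2]] m2 in \<open>auto simp: walk_simps idx_walk_seg[OF path]\<close>)
        then show ?thesis using le[of i] False by simp
      qed
    qed
  qed
  have "\<exists>j \<le> 2 * m. E z (x j)"
  proof (rule ccontr)
    assume no: "\<not> ?thesis"
    have "{u. E z u} \<subseteq> {x (2 * m + 1), x (2 * m + 3)}"
    proof
      fix u assume "u \<in> {u. E z u}"
      then have u: "E z u" by simp
      then obtain j where j: "j \<le> 2 * m + 3" "u = x j" using nb by blast
      have "j \<noteq> 2 * m + 2" using u j E_irrefl unfolding z_def by metis
      moreover have "\<not> j \<le> 2 * m" using no u j by blast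
      ultimately have "j = 2 * m + 1 \<or> j = 2 * m + 3" using j by linarith
      then show "u \<in> {x (2 * m + 1), x (2 * m + 3)}" using j by blast
    qed
    then have "card {u. E z u} \<le> card {x (2 * m + 1), x (2 * m + 3)}" by (intro card_mono) auto
    also have "\<dots> \<le> 2" by (simp add: card_insert_if)
    finally have "card {u. E z u} \<le> 2" .
    moreover have "z \<in> V" using idx_pathD(2)[OF path, of "2 * m + 2"] N E_V unfolding z_def by simp
    ultimately show False using degree[of z] k3 by simp
  qed
  then obtain j where j: "j \<le> 2 * m" "E z (x j)" by blast
  \<comment> \<open>This order puts \<open>x 0\<close> at position \<open>2 * m + 2\<close>, and
    \<open>x 0\<close> is adjacent to the new start \<open>x (j + 1)\<close>.\<close>
  define p where "p = seg (j + 1) (2 * m + 2) @ seg j 0 @ seg (2 * m + 3) N"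
  have d: "distinct p" "set p = {..N}" unfolding p_def using j N by auto
  have "idx_walk x p"
    unfolding p_def using j t' N unfolding z_def by (auto simp: walk_simps idx_walk_seg[OF path])
  then have "longest_path (\<lambda>i. x (p ! i)) N"
    using idx_path_reorder[OF path d] lp unfolding longest_path_def by blast
  moreover have "p ! 0 = j + 1" unfolding p_def by (simp add: nth_append hd_conv_nth[symmetric])
  moreover have "p ! (2 * m + 2) = 0"
  proof -
    have "seg j 0 ! j = last (seg j 0)" by (subst last_conv_nth) simp_all
    moreover have "length (seg (j + 1) (2 * m + 2)) = 2 * m + 2 - j" using j by simp
    moreover have "\<not> 2 * m + 2 < 2 * m + 2 - j" "2 * m + 2 - (2 * m + 2 - j) = j" using j by simp_all
    moreover have "j < length (seg j 0)" by simp
    ultimately show ?thesis unfolding p_def nth_append by (simp only: if_False if_True seg_simps simp_thms)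
  qed
  ultimately have "2 * m + 2 \<le> 2 * m"
    using extremal[of "\<lambda>i. x (p ! i)" "2 * m + 2"] N E_sym[OF adj[of "j + 1"]] j by simp
  then show False by simp
qed

end

context even_config
begin

interpretation flp: even_config V E k y N m
  by (rule config_flip)

text \<open>Otherwise the tight counts leave a single longer length, of code \<open>n\<close>, and
  the same two tail chords at both starts. Reflection in their codes \<open>R\<close> and
  \<open>R + n\<close> forces the ends \<open>2 * m + 1\<close> and \<open>2 * m + 3\<close>, which
  \<open>two_tails_False\<close> excludes.\<close>

lemma codes_eq_F: "codes m = F"
proof (rule ccontr)
  assume neg: "codes m \<noteq> F"
  have ne: "tx \<noteq> {}" "ty \<noteq> {}" using no_tail flp.no_tail neg by blast+
  define s where "s = Min (tx \<union> ty)"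
  have s: "s \<in> tx \<union> ty" "\<And>t. t \<in> tx \<union> ty \<Longrightarrow> s \<le> t"
    using ne tail_finite flp.tail_finite Min_in[of "tx \<union> ty"] unfolding s_def by auto
  have sy: "s \<in> ty \<Longrightarrow> s \<in> tx \<and> card tx = 2 \<and> card (codes m - F) = 1 \<and> card F + 1 = k"
    using flp.min_tail_two[of s] s(2) neg unfolding flip_involution by blast
  have st: "s \<in> tx" "s \<in> ty" "card tx = 2" "card ty = 2" "card (codes m - F) = 1" "card F + 1 = k"
    using min_tail_two[OF _ s(2) neg] sy s(1) by blast+
  obtain t where t: "tx = {s, t}" "t \<noteq> s"
    using st(1,3) unfolding card_2_iff by fastforce
  obtain u where u: "ty = {s, u}" "u \<noteq> s"
    using st(2,4) unfolding card_2_iff by fastforce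
  have odds: "odd s" "odd t" "odd u" using tail_odd flp.tail_odd t u by auto
  have less: "s < t" "s < u" using s(2) t u by (auto simp: le_less)
  obtain n where n: "codes m - F = {n}" using st(5) card_1_singletonE by blast
  have par: "\<exists>h. 2 * h = int a - int b" if "odd a" "odd b" for a b
  proof -
    have "even (int a - int b)" using that by simp
    then show ?thesis by (metis evenE)
  qed
  obtain h where h: "2 * h = int s - int u" using par[OF odds(1,3)] by blast
  obtain h' where h': "2 * h' = int s - int t" using par[OF odds(1,2)] by blast
  have "h \<in> codes m"
    by (rule long_code[OF st(1) _ u(2)[symmetric]]) (use u(1) h less in auto)
  moreover have "h < 0" using h less by linarith
  ultimately have "h \<in> codes m - F" unfolding F_def by simp
  then have "h = n" unfolding n by simp
  have "h' \<in> codes m"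
    by (rule long_code[OF _ st(2) t(2)]) (use t(1) h' less in auto)
  moreover have "h' < 0" using h' less by linarith
  ultimately have "h' \<in> codes m - F" unfolding F_def by simp
  then have "h' = n" unfolding n by simp
  then have n2: "int t = int s - 2 * n" using h' by linarith
  have n0: "n < 0" using n2 less by simp
  have cF: "2 * card F \<le> card ex + card ox" "2 * card F \<le> card ey + card oy"
    using chord_count flp.chord_count st by linarith+
  have all: "ex = F" "ox = F" "oy = F"
    by (fact all_full[OF F_bounds(2) chords_F cF(1)] all_full[OF F_bounds(2) flp.chords_F cF(2)])+
  have full: "F = {0..<int m}" using full_if_all_chords[OF all] st(6) k3 by simp
  have m2: "2 \<le> m" using card_F_le st(6) k3 by linarith
  obtain R where R: "int s = 4 * int m - 1 - 2 * R" using tail_even st by blast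
  have Q: "int t = 4 * int m - 1 - 2 * (R + n)" using R n2 by simp
  have cod: "h \<in> codes m \<Longrightarrow> (0 \<le> h \<and> h < int m) \<or> h = n" for h
  proof -
    assume "h \<in> codes m"
    then consider "h \<in> F" | "h \<in> codes m - F" by blast
    then show ?thesis
    proof cases
      case 1 then show ?thesis unfolding full by simp
    next
      case 2 then show ?thesis unfolding n by simp
    qed
  qed
  have rr: "R - f \<in> codes m" "R + n - f \<in> codes m" if "0 \<le> f" "f < int m" for f
  proof -
    have "f \<in> ex \<or> f \<in> ey" using that unfolding all(1) full by simp
    moreover have "s \<in> tx \<union> ty" "t \<in> tx \<union> ty" using st(1) t(1) by blast+
    ultimately show "R - f \<in> codes m" "R + n - f \<in> codes m"
      using reflect[OF _ R m2] reflect[OF _ Q m2] by blast+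
  qed
  have "s > 2 * m" using st(1) unfolding tail_chords_def by simp
  then have "R \<le> int m - 1" using R by simp
  \<comment> \<open>The code \<open>R + n - (m - 1)\<close> is nonnegative or equal to
    \<open>n\<close>.\<close>
  moreover have "R \<ge> int m - 1"
    using cod[OF rr(2)[of "int m - 1"]] cod[OF rr(1)[of "int m - 1"]] m2 n0 by linarith
  ultimately have R1: "R = int m - 1" by simp
  \<comment> \<open>Here \<open>R + n - (m - 2)\<close> equals \<open>n + 1\<close>, a code only if
    \<open>n + 1\<close> is nonnegative.\<close>
  have "n = -1" using cod[OF rr(2)[of "int m - 2"]] m2 n0 R1 by linarith
  then have "s = 2 * m + 1" "t = 2 * m + 3" using R R1 n2 by auto
  moreover have "l \<le> 2 * m + 3" if "l \<in> odd_lengths" for l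
  proof -
    have "(2 * int m + 1 - int l) div 2 \<ge> -1" using cod[OF mem_codes_length[OF that]] \<open>n = -1\<close> by auto
    then show ?thesis by simp
  qed
  ultimately show False using two_tails_False[OF full all(1,2) m2] t by blast
qed

text \<open>Without negative codes a tail chord at one start has the same end as any at the other.
  So if both starts have tail chords, each has exactly one; if one start has none,
  \<open>no_tail\<close> bounds the other. The pairing loses at most one chord per start.\<close>

lemma config_full: "F = {0..<int m}" "tx \<subseteq> {2 * m + 1}" "m = k"
proof -
  have card_le: "card F \<le> k" using card_F_neg by linarith
  have c: "card F = k \<and> 2 * k \<le> card ex + card ox + 1 \<and> 2 * k \<le> card ey + card oy + 1"
  proof (cases "tx = {} \<or> ty = {}")
    case True
    then show ?thesis
    proof
      assume e: "tx = {}"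
      from no_tail[OF e] show ?thesis by simp
    next
      assume e: "ty = {}"
      from flp.no_tail[OF e] show ?thesis unfolding flip_involution by simp
    qed
  next
    case False
    have eq: "s = t" if st: "s \<in> tx" "t \<in> ty" for s t
    proof (rule ccontr)
      assume ne: "s \<noteq> t"
      have "odd s" "odd t" using tail_odd flp.tail_odd st by blast+
      then have e: "2 * (- \<bar>int s - int t\<bar> div 2) = - \<bar>int s - int t\<bar>" by presburger
      have "- \<bar>int s - int t\<bar> div 2 \<in> F" using long_code[OF st ne e] unfolding codes_eq_F .
      moreover have "- \<bar>int s - int t\<bar> div 2 < 0" using e ne by linarith
      ultimately show False unfolding F_def by simp
    qed
    have "card tx \<le> Suc 0" "card ty \<le> Suc 0"
      using False eq card_le_Suc0_iff_eq[OF tail_finite] card_le_Suc0_iff_eq[OF flp.tail_finite] by blast+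
    then have *: "2 * k \<le> card ex + card ox + 1" "2 * k \<le> card ey + card oy + 1"
      using chord_count flp.chord_count by linarith+
    then have "card F = k" using card_chords card_le by linarith
    then show ?thesis using * by blast
  qed
  have *: "F = {0..<int m} \<and> tx \<subseteq> {2 * m + 1}"
  proof (cases "tx \<union> ty = {}")
    case True
    have "ex = F" "ox = F" using no_tail True by blast+
    moreover have "oy = F" using flp.no_tail(2) True by blast
    ultimately show ?thesis using full_if_all_chords c k3 True by auto
  next
    case False
    then show ?thesis using full_if_almost_all_chords[OF codes_eq_F] c by blast
  qed
  then show "F = {0..<int m}" "tx \<subseteq> {2 * m + 1}" by blast+
  show "m = k" using * c by simp
qed

end

context even_config
begin

interpretation flp: even_config V E k y N m
  by (rule config_flip)

section \<open>Vertices outside the odd cycle\<close>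

lemma odd_lengths_eq: "odd_lengths = {l. odd l \<and> 3 \<le> l \<and> l \<le> 2 * k + 1}"
proof (intro set_eqI iffI)
  fix l assume l: "l \<in> odd_lengths"
  have "(2 * int m + 1 - int l) div 2 \<in> F" using mem_codes_length[OF l, of m] unfolding codes_eq_F .
  then have "0 \<le> (2 * int m + 1 - int l) div 2" unfolding config_full(1) by simp
  then have "l \<le> 2 * m + 1" by linarith
  then show "l \<in> {l. odd l \<and> 3 \<le> l \<and> l \<le> 2 * k + 1}"
    using odd_lengths_ge3[OF l] unfolding config_full(3) by simp
next
  fix l assume "l \<in> {l. odd l \<and> 3 \<le> l \<and> l \<le> 2 * k + 1}"
  then have l: "odd l" "3 \<le> l" "l \<le> 2 * m + 1" unfolding config_full(3) by auto
  obtain j where j: "l = 2 * j + 1" using l(1) by (elim oddE)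
  have "int m - int j \<in> codes m" unfolding codes_eq_F config_full(1) using l j by simp
  then obtain l' where "l' \<in> odd_lengths" "int l' = 2 * int m + 1 - 2 * (int m - int j)"
    unfolding codes_def by blast
  moreover from this have "l' = l" using j by simp
  ultimately show "l \<in> odd_lengths" by simp
qed

lemma odd_length_le: "l \<in> odd_lengths \<Longrightarrow> l \<le> 2 * m + 1"
  unfolding odd_lengths_eq config_full(3) by simp

lemma N_pos: "0 < N"
  using m by simp

lemma start_neighbours:
  assumes "E (x 0) w" shows "\<exists>i\<le>N. 0 < i \<and> i \<le> 2 * m + 1 \<and> w = x i"
proof -
  obtain i where i: "i \<le> N" "0 < i" "w = x i" using longest_path_neighbours[OF lp N_pos assms] by blast
  have "i \<le> 2 * m + 1"
  proof (rule ccontr)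
    assume "\<not> i \<le> 2 * m + 1"
    then have "i \<in> tx" using i assms unfolding tail_chords_def by simp
    then show False using config_full(2) \<open>\<not> i \<le> 2 * m + 1\<close> by blast
  qed
  then show ?thesis using i by blast
qed

text \<open>Of the \<open>2 * m + 1\<close> candidates \<open>x 1\<close>, ...,
  \<open>x (2 * m + 1)\<close> at least \<open>2 * m\<close> are neighbours of \<open>x 0\<close>,
  because \<open>m = k\<close>.\<close>

lemma missing:
  shows "\<And>s t. 1 \<le> s \<Longrightarrow> s \<le> 2 * m \<Longrightarrow> 1 \<le> t \<Longrightarrow> t \<le> 2 * m \<Longrightarrow> \<not> E (x 0) (x s) \<Longrightarrow> \<not> E (x 0) (x t) \<Longrightarrow> s = t"
    and "\<And>s. 1 \<le> s \<Longrightarrow> s \<le> 2 * m \<Longrightarrow> \<not> E (x 0) (x s) \<Longrightarrow> E (x 0) (x (2 * m + 1)) \<and> 2 * m + 1 \<le> N"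
proof -
  define M where "M = {s. 1 \<le> s \<and> s \<le> 2 * m \<and> \<not> E (x 0) (x s)}"
  have sub: "M \<subseteq> {1..2 * m}" unfolding M_def by auto
  then have fin: "finite M" using finite_subset by blast
  have cd: "card ({1..2 * m} - M) = 2 * m - card M" using sub fin by (simp add: card_Diff_subset)
  have cM: "card M \<le> 2 * m" using card_mono[OF _ sub] by simp
  have nb: "{u. E (x 0) u} \<subseteq> x ` (({1..2 * m} - M) \<union> T)"
    if "\<And>i. E (x 0) (x i) \<Longrightarrow> i \<le> N \<Longrightarrow> i = 2 * m + 1 \<Longrightarrow> i \<in> T" for T
  proof
    fix u assume "u \<in> {u. E (x 0) u}"
    then obtain i where i: "i \<le> N" "0 < i" "i \<le> 2 * m + 1" "u = x i" "E (x 0) (x i)" using start_neighbours by blast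
    have "i \<in> ({1..2 * m} - M) \<union> T"
      using that[OF i(5,1)] i unfolding M_def by (cases "i = 2 * m + 1") auto
    then show "u \<in> x ` (({1..2 * m} - M) \<union> T)" using i by blast
  qed
  have deg: "2 * m \<le> card (({1..2 * m} - M) \<union> T)"
    if "\<And>i. E (x 0) (x i) \<Longrightarrow> i \<le> N \<Longrightarrow> i = 2 * m + 1 \<Longrightarrow> i \<in> T" and "finite T" for T
  proof -
    have "2 * m \<le> card {u. E (x 0) u}" using degree[OF E_V[OF close]] unfolding config_full(3) .
    also have "\<dots> \<le> card (x ` (({1..2 * m} - M) \<union> T))" using nb[OF that(1)] that(2) by (intro card_mono) auto
    also have "\<dots> \<le> card (({1..2 * m} - M) \<union> T)" using that(2) by (intro card_image_le) auto
    finally show ?thesis .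
  qed
  have "2 * m \<le> card (({1..2 * m} - M) \<union> {2 * m + 1})" by (rule deg) auto
  also have "\<dots> \<le> 2 * m - card M + 1" using card_Un_le[of "{1..2 * m} - M" "{2 * m + 1}"] cd by simp
  finally have "card M \<le> Suc 0" using cM by linarith
  then have eq: "\<forall>a\<in>M. \<forall>b\<in>M. a = b" using card_le_Suc0_iff_eq[OF fin] by blast
  show "s = t" if "1 \<le> s" "s \<le> 2 * m" "1 \<le> t" "t \<le> 2 * m" "\<not> E (x 0) (x s)" "\<not> E (x 0) (x t)" for s t
    using eq that unfolding M_def by blast
  show "E (x 0) (x (2 * m + 1)) \<and> 2 * m + 1 \<le> N" if "1 \<le> s" "s \<le> 2 * m" "\<not> E (x 0) (x s)" for s
  proof (rule ccontr)
    assume no: "\<not> ?thesis"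
    have "2 * m \<le> card (({1..2 * m} - M) \<union> {})" by (rule deg) (use no in auto)
    then have "card M = 0" using cd cM by simp
    then show False using fin that unfolding M_def by auto
  qed
qed

text \<open>
  A neighbour \<open>x j\<close> with \<open>j\<close> large closes an odd cycle of length \<open>j + 1\<close> through \<open>p\<close> or of
  length \<open>j\<close> through \<open>q\<close>, which omits one vertex; a neighbour off the path makes the path longer.
\<close>

lemma exit_bound:
  assumes b: "b \<le> 2 * m + 1" "b \<le> N"
    and p: "distinct p" "set p = {..b}" "hd p = a" "last p = b" "idx_walk x p"
    and q: "distinct q" "set q \<subseteq> {..b}" "length q = b" "hd q = a" "last q = b" "idx_walk x q"
    and w: "E (x a) w" and b0: "0 < b"
  shows "\<exists>j\<le>N. j \<le> 2 * m + 1 \<and> w = x j"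
proof (rule ccontr)
  assume no: "\<not> ?thesis"
  have lp': "length p = b + 1" using distinct_card[OF p(1)] p(2) by simp
  have ne: "p \<noteq> []" "q \<noteq> []" using lp' q(3) b0 by auto
  show False
  proof (cases "w \<in> x ` {..N}")
    case True
    then obtain j where j: "j \<le> N" "w = x j" by blast
    have j2: "2 * m + 2 \<le> j"
    proof (rule ccontr)
      assume "\<not> 2 * m + 2 \<le> j"
      then have "j \<le> 2 * m + 1" by simp
      then show False using no j by blast
    qed
    then have j3: "3 \<le> j" using m by simp
    have sset: "set (seg (Suc b) j) = {Suc b..j}" using j2 b(1) by simp
    have ja: "E (x j) (x a)" using E_sym[OF w] j by simp
    have st: "E (x b) (x (Suc b))" using idx_pathD(2)[OF path, of b] j j2 b by simp
    show False
    proof (cases "even j")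
      case True
      then have o: "odd (j + 1)" by simp
      have "j + 1 \<in> odd_lengths"
      proof (rule idx_cycle[OF idx_pathD(1)[OF path] o, where p = "p @ seg (Suc b) j"])
        show "j + 1 = length (p @ seg (Suc b) j)" using lp' j2 b(1) by simp
        show "3 \<le> j + 1" using j3 by simp
        show "distinct (p @ seg (Suc b) j)" unfolding distinct_append sset using p(1,2) by auto
        show "set (p @ seg (Suc b) j) \<subseteq> {..N}" unfolding set_append sset using p(2) j(1) b by auto
        show "idx_walk x (p @ seg (Suc b) j)"
          using p(4,5) ne st j(1) j2 b by (simp add: walk_simps idx_walk_seg[OF path])
        show "E (x (last (p @ seg (Suc b) j))) (x (hd (p @ seg (Suc b) j)))"
          using p(3) ne ja by simp
      qed
      then show False using odd_length_le j2 by force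
    next
      case odd: False
      have "j \<in> odd_lengths"
      proof (rule idx_cycle[OF idx_pathD(1)[OF path] odd, where p = "q @ seg (Suc b) j"])
        show "j = length (q @ seg (Suc b) j)" using q(3) j2 b(1) by simp
        show "3 \<le> j" using j3 by simp
        show "distinct (q @ seg (Suc b) j)" unfolding distinct_append sset using q(1,2) by auto
        show "set (q @ seg (Suc b) j) \<subseteq> {..N}" unfolding set_append sset using q(2) j(1) b by auto
        show "idx_walk x (q @ seg (Suc b) j)"
          using q(5,6) ne st j(1) j2 b by (simp add: walk_simps idx_walk_seg[OF path])
        show "E (x (last (q @ seg (Suc b) j))) (x (hd (q @ seg (Suc b) j)))"
          using q(4) ne ja by simp
      qed
      then show False using odd_length_le j2 odd by force
    qed
  next
    case False
    have "\<exists>r. distinct r \<and> set r = {..N} \<and> hd r = a \<and> idx_walk x r"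
    proof (cases "b < N")
      case True
      have sset: "set (seg (Suc b) N) = {Suc b..N}" using True by simp
      have "distinct (p @ seg (Suc b) N)" unfolding distinct_append sset using p(1,2) by auto
      moreover have "set (p @ seg (Suc b) N) = {..N}" unfolding set_append sset p(2) using True by auto
      moreover have "idx_walk x (p @ seg (Suc b) N)"
        using p(4,5) ne True idx_pathD(2)[OF path, of b] by (simp add: walk_simps idx_walk_seg[OF path])
      moreover have "hd (p @ seg (Suc b) N) = a" using p(3) ne by simp
      ultimately show ?thesis by blast
    next
      case False
      then have "b = N" using b by simp
      then show ?thesis using p by blast
    qed
    then obtain r where r: "distinct r" "set r = {..N}" "hd r = a" and "idx_walk x r" by blast
    then have sr: "successively E (map x r)" by (simp add: successively_map)
    have lr: "length r = Suc N" using distinct_card[OF r(1)] r(2) by simp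
    then have ln: "2 \<le> length (map x r)" using N_pos by simp
    have "distinct (map x r)" unfolding distinct_map using r idx_pathD(1)[OF path] by simp
    moreover have "hd (map x r) = x a" using r(3) lr by (cases r) auto
    ultimately have "upath (w # map x r)"
      unfolding upath_def using sr set_in_V[OF sr ln] E_V2[OF w] E_sym[OF w] False r(2)
      by (simp add: successively_Cons)
    then have "length (w # map x r) \<le> Suc N" using lp unfolding longest_path_def by blast
    then show False using lr by simp
  qed
qed

lemma m3: "3 \<le> m"
  using k3 config_full(3) by simp

text \<open>The path omits \<open>x 0\<close>, \<open>x 1\<close> or \<open>x (i + 1)\<close>. As at
  most one chord at \<open>x 0\<close> is absent, either the chord to \<open>x (i + 2)\<close>
  exists or both chords to \<open>x 2\<close> and \<open>x (i + 1)\<close> do.\<close>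

lemma near_path:
  assumes "1 \<le> i" "i + 2 \<le> 2 * m"
  shows "\<exists>q. distinct q \<and> set q \<subseteq> {..2 * m} \<and> length q = 2 * m \<and> hd q = i \<and> last q = 2 * m \<and> idx_walk x q"
proof -
  note w = walk_simps idx_walk_seg[OF path]
  consider "i = 1" | "2 \<le> i" "E (x 0) (x 2)" "E (x 0) (x (i + 1))" | "2 \<le> i" "E (x 0) (x (i + 2))"
    using missing(1)[of "i + 2" 2] missing(1)[of "i + 2" "i + 1"] assms by fastforce
  then show ?thesis
  proof cases
    case 1
    then show ?thesis
      by (intro exI[of _ "seg 1 (2 * m)"]) (use m in \<open>auto simp: idx_walk_seg[OF path]\<close>)
  next
    case 2
    show ?thesis
      by (intro exI[of _ "seg i 2 @ 0 # seg (i + 1) (2 * m)"])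
         (use 2 assms m E_sym[OF 2(2)] in \<open>auto simp: w\<close>)
  next
    case 3
    show ?thesis
      by (intro exI[of _ "seg i 0 @ seg (i + 2) (2 * m)"])
         (use 3 assms m in \<open>auto simp: w\<close>)
  qed
qed

end

section \<open>Neighbourhoods of the vertices of the odd cycle\<close>

context even_config
begin

interpretation flp: even_config V E k y N m
  by (rule config_flip)

lemma flip_start_neighbours:
  assumes "E (x (2 * m - 1)) w" shows "\<exists>j\<le>N. j \<le> 2 * m + 1 \<and> w = x j"
proof -
  have "E (y 0) w" using assms m unfolding flip_def by simp
  then obtain i where i: "i \<le> N" "i \<le> 2 * m + 1" "w = y i" using flp.start_neighbours by blast
  show ?thesis
  proof (cases "i < 2 * m")
    case True
    then show ?thesis using i m unfolding flip_def by (intro exI[of _ "2 * m - 1 - i"]) auto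
  next
    case False
    then show ?thesis using i unfolding flip_def by auto
  qed
qed

text \<open>A path from \<open>x i\<close> to \<open>x (2 * m)\<close> that spans the cycle makes
  \<open>x i\<close> the start of a longest path, and \<open>near_path\<close> supplies the
  companion of the other parity. The two starts are known already.\<close>

lemma ham_neighbours:
  assumes i: "i < 2 * m" and p: "distinct p" "set p = {..2 * m}" "hd p = i" "last p = 2 * m" "idx_walk x p"
    and w: "E (x i) w"
  shows "\<exists>j\<le>N. j \<le> 2 * m + 1 \<and> w = x j"
proof -
  consider "i = 0" | "i = 2 * m - 1" | "1 \<le> i" "i + 2 \<le> 2 * m" using i by linarith
  then show ?thesis
  proof cases
    case 1 then show ?thesis using start_neighbours w by blast
  next
    case 2 then show ?thesis using flip_start_neighbours w by blast
  next
    case 3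
    then obtain q where "distinct q" "set q \<subseteq> {..2 * m}" "length q = 2 * m" "hd q = i" "last q = 2 * m" "idx_walk x q"
      using near_path by blast
    then show ?thesis using exit_bound[OF _ m(2) p, of q] w m by simp
  qed
qed

lemma rotated_neighbours:
  assumes i: "i < 2 * m" "E (x 0) (x (i + 1))" and w: "E (x i) w"
  shows "\<exists>j\<le>N. j \<le> 2 * m + 1 \<and> w = x j"
  by (rule ham_neighbours[OF i(1) _ _ _ _ _ w, where p = "seg i 0 @ seg (i + 1) (2 * m)"])
     (use i m in \<open>auto simp: walk_simps idx_walk_seg[OF path]\<close>)

lemma almost_adjacent:
  assumes i: "i < 2 * m" "E (x 0) (x (i + 1))" and st: "s \<noteq> i" "t \<noteq> i" "s \<noteq> t" "s \<le> 2 * m" "t \<le> 2 * m"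
    and n: "\<not> E (x i) (x s)"
  shows "E (x i) (x t)"
proof (rule ccontr)
  assume n': "\<not> E (x i) (x t)"
  have "{u. E (x i) u} \<subseteq> x ` ({..2 * m + 1} - {i, s, t})"
  proof
    fix u assume "u \<in> {u. E (x i) u}"
    then have u: "E (x i) u" by simp
    obtain j where j: "j \<le> 2 * m + 1" "u = x j" using rotated_neighbours[OF i u] by blast
    have "j \<noteq> i" "j \<noteq> s" "j \<noteq> t" using u j n n' E_irrefl by metis+
    then show "u \<in> x ` ({..2 * m + 1} - {i, s, t})" using j by blast
  qed
  then have "card {u. E (x i) u} \<le> card (x ` ({..2 * m + 1} - {i, s, t}))" by (intro card_mono) auto
  also have "\<dots> \<le> card ({..2 * m + 1} - {i, s, t})" by (intro card_image_le) auto
  also have "\<dots> = 2 * m - 1" using i st by (subst card_Diff_subset) auto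
  finally have "card {u. E (x i) u} \<le> 2 * m - 1" .
  moreover have "x i \<in> V" using idx_pathD(2)[OF path, of i] i m E_V by simp
  ultimately show False using degree[of "x i"] m unfolding config_full(3) by simp
qed

text \<open>Rotation settles every \<open>i\<close> with a chord from \<open>x 0\<close> to
  \<open>x (i + 1)\<close>. In the single exceptional case \<open>x (i + 1)\<close> already lacks
  \<open>x 0\<close>, so by its degree it is adjacent to all other vertices of the cycle, and a
  spanning path can be rerouted through it.\<close>

lemma inner_neighbours:
  assumes i: "i < 2 * m" and w: "E (x i) w"
  shows "\<exists>j\<le>N. j \<le> 2 * m + 1 \<and> w = x j"
proof (cases "E (x 0) (x (i + 1))")
  case True
  then show ?thesis using rotated_neighbours[OF i _ w] by blast
next
  case False
  have i1: "1 \<le> i" using False idx_pathD(2)[OF path, of 0] m by (cases i) auto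
  have i2: "i + 2 \<le> 2 * m"
  proof (rule ccontr)
    assume "\<not> ?thesis"
    then have "i + 1 = 2 * m" using i by simp
    then show False using False close by simp
  qed
  have adj: "E (x 0) (x s)" if "1 \<le> s" "s \<le> 2 * m" "s \<noteq> i + 1" for s
    using missing(1)[of s "i + 1"] that i2 False by auto
  have n: "\<not> E (x (i + 1)) (x 0)" using False E_sym by blast
  have am: "E (x (i + 1)) (x t)" if "t \<noteq> i + 1" "t \<noteq> 0" "t \<le> 2 * m" for t
    by (rule almost_adjacent[OF _ _ _ _ _ _ _ n]) (use that i1 i2 adj[of "i + 2"] in auto)
  show ?thesis
  proof (cases "i = 1")
    case True
    have "E (x 1) (x 0)" using adj[of 1] m3 True E_sym by simp
    moreover have "E (x 0) (x 3)" using adj[of 3] m3 True by simp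
    moreover have "E (x 2) (x 4)" using am[of 4] m3 True by (simp add: numeral_2_eq_2)
    moreover have "E (x 3) (x 2)" using idx_pathD(2)[OF path, of 2] m m3 E_sym by simp
    ultimately show ?thesis
      by (intro ham_neighbours[OF i _ _ _ _ _ w, where p = "1 # 0 # 3 # 2 # seg 4 (2 * m)"])
         (use m3 m True in \<open>auto simp: walk_simps idx_walk_seg[OF path]\<close>)
  next
    case False
    have "E (x 2) (x 0)" using adj[of 2] m3 False i1 E_sym by simp
    moreover have "E (x 1) (x (i + 1))" using am[of 1] E_sym i1 m by simp
    moreover have "E (x 0) (x 1)" using adj[of 1] m i1 by simp
    ultimately show ?thesis
      by (intro ham_neighbours[OF i _ _ _ _ _ w, where p = "seg i 2 @ 0 # 1 # seg (i + 1) (2 * m)"])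
         (use m3 m False i1 i2 in \<open>auto simp: walk_simps idx_walk_seg[OF path]\<close>)
  qed
qed

text \<open>Moving \<open>x 0\<close> behind \<open>x (2 * m)\<close> gives another extremal
  configuration. There \<open>x (2 * m)\<close> has position \<open>2 * m - 1\<close>, so it is the
  flipped start.\<close>

lemma tail_vertex_neighbours:
  assumes t: "E (x 0) (x (2 * m + 1))" "2 * m + 1 \<le> N" and w: "E (x (2 * m)) w"
  shows "\<exists>j\<le>N. j \<le> 2 * m + 1 \<and> w = x j"
proof -
  define p where "p = seg 1 (2 * m) @ 0 # seg (2 * m + 1) N"
  have d: "distinct p" "set p = {..N}" using m t unfolding p_def by auto
  have "idx_walk x p"
    unfolding p_def using m t E_sym[OF close] by (auto simp: walk_simps idx_walk_seg[OF path])
  then have lp': "longest_path (\<lambda>i. x (p ! i)) N"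
    using idx_path_reorder[OF path d] lp unfolding longest_path_def by blast
  have p0: "p ! 0 = 1" unfolding p_def using m by (simp add: nth_append hd_conv_nth[symmetric])
  have p2: "p ! (2 * m) = 0" unfolding p_def using m by (simp add: nth_append)
  have "seg 1 (2 * m) ! (2 * m - 1) = last (seg 1 (2 * m))" using m by (subst last_conv_nth) simp_all
  then have p1: "p ! (2 * m - 1) = 2 * m" unfolding p_def using m by (simp add: nth_append)
  have "E (x (p ! 0)) (x (p ! (2 * m)))"
    unfolding p0 p2 using E_sym[OF idx_pathD(2)[OF path, of 0]] m by simp
  then interpret c: even_config V E k "\<lambda>i. x (p ! i)" N m
    by unfold_locales (use lp' m extremal in auto)
  have "E (x (p ! (2 * m - 1))) w" unfolding p1 by (rule w)
  from c.flip_start_neighbours[OF this] obtain j where j: "j \<le> N" "j \<le> 2 * m + 1" "w = x (p ! j)" by blast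
  have lenp: "length p = Suc N" using distinct_card[OF d(1)] d(2) by simp
  have take: "p ! i \<le> 2 * m + 1" if "i \<le> 2 * m + 1" for i
  proof -
    have "p = (seg 1 (2 * m) @ [0, 2 * m + 1]) @ (if 2 * m + 1 < N then seg (2 * m + 2) N else [])"
      using t(2) unfolding p_def seg_def by (auto simp: upt_conv_Cons simp del: upt_Suc)
    moreover have "length (seg 1 (2 * m) @ [0, 2 * m + 1]) = 2 * m + 2" using m by simp
    ultimately have "p ! i = (seg 1 (2 * m) @ [0, 2 * m + 1]) ! i" using that by (simp only: nth_append split: if_split) auto
    also have "\<dots> \<in> set (seg 1 (2 * m) @ [0, 2 * m + 1])" using that m by (intro nth_mem) simp
    also have "\<dots> \<subseteq> {..2 * m + 1}" using m by auto
    finally show ?thesis by simp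
  qed
  have "p ! j \<in> {..N}" using d(2) lenp j by (metis le_imp_less_Suc nth_mem)
  then show ?thesis using j take by auto
qed

end

context even_config
begin

interpretation flp: even_config V E k y N m
  by (rule config_flip)

text \<open>Suppose that some vertex is left over. Deleting \<open>x (2 * m)\<close> yields an edge
  from an earlier \<open>x i\<close> to \<open>x (2 * m + 1)\<close>; deleting
  \<open>x (2 * m + 1)\<close> then yields an edge from \<open>x (2 * m)\<close> to a vertex
  outside. This excludes \<open>x (2 * m + 1)\<close> as a neighbour of \<open>x 0\<close>, so all
  chords at \<open>x 0\<close> within the cycle exist, and \<open>exit_bound\<close> applies at
  \<open>x (2 * m)\<close>.\<close>

lemma few_vertices: "card V \<le> 2 * k + 2"
proof -
  have "V \<subseteq> x ` {..2 * m + 1}"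
  proof (rule ccontr)
    assume no: "\<not> ?thesis"
    have inj: "inj_on x {..N}" using idx_pathD(1)[OF path] .
    have xV: "x i \<in> V" if "i \<le> N" for i
    proof (cases "i = N")
      case True then show ?thesis using idx_pathD(3)[OF path, of N] N_pos E_V2 by simp
    next
      case False then show ?thesis using idx_pathD(2)[OF path, of i] that E_V by simp
    qed
    have "\<exists>u\<in>x ` {..<2 * m}. \<exists>v\<in>V - {x (2 * m)} - x ` {..<2 * m}. E u v"
    proof (rule no_cut_vertex)
      show "x ` {..<2 * m} \<subseteq> V - {x (2 * m)}"
        using xV m inj unfolding inj_on_def by fastforce
      show "x ` {..<2 * m} \<noteq> {}" using m by (simp add: lessThan_empty_iff)
      show "V - {x (2 * m)} - x ` {..<2 * m} \<noteq> {}"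
      proof
        assume "V - {x (2 * m)} - x ` {..<2 * m} = {}"
        then have "V \<subseteq> x ` insert (2 * m) {..<2 * m}" by auto
        also have "\<dots> \<subseteq> x ` {..2 * m + 1}" by (intro image_mono) auto
        finally show False using no by blast
      qed
    qed
    then obtain i v where i: "i < 2 * m" "E (x i) v" "v \<noteq> x (2 * m)" "v \<notin> x ` {..<2 * m}" by blast
    obtain j where j: "j \<le> N" "j \<le> 2 * m + 1" "v = x j" using inner_neighbours[OF i(1,2)] by blast
    have "j = 2 * m + 1"
    proof (rule ccontr)
      assume "j \<noteq> 2 * m + 1"
      then have "j < 2 * m \<or> j = 2 * m" using j by linarith
      then show False using i j by blast
    qed
    then have iE: "E (x i) (x (2 * m + 1))" and N1: "2 * m + 1 \<le> N" using i j by auto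
    have "\<exists>u\<in>x ` {..2 * m}. \<exists>v\<in>V - {x (2 * m + 1)} - x ` {..2 * m}. E u v"
    proof (rule no_cut_vertex)
      show "x ` {..2 * m} \<subseteq> V - {x (2 * m + 1)}"
        using xV N1 inj unfolding inj_on_def by fastforce
      show "x ` {..2 * m} \<noteq> {}" by auto
      show "V - {x (2 * m + 1)} - x ` {..2 * m} \<noteq> {}"
      proof
        assume "V - {x (2 * m + 1)} - x ` {..2 * m} = {}"
        then have "V \<subseteq> x ` insert (2 * m + 1) {..2 * m}" by auto
        also have "\<dots> \<subseteq> x ` {..2 * m + 1}" by (intro image_mono) auto
        finally show False using no by blast
      qed
    qed
    then obtain a w where a: "a \<le> 2 * m" "E (x a) w" "w \<noteq> x (2 * m + 1)" "w \<notin> x ` {..2 * m}" by blast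
    have out: "\<not> (\<exists>j\<le>N. j \<le> 2 * m + 1 \<and> w = x j)"
    proof
      assume "\<exists>j\<le>N. j \<le> 2 * m + 1 \<and> w = x j"
      then obtain j where "j \<le> 2 * m + 1" "w = x j" by blast
      then have "j \<le> 2 * m \<or> j = 2 * m + 1" by linarith
      then show False using a \<open>w = x j\<close> by blast
    qed
    have "a = 2 * m"
    proof (rule ccontr)
      assume "a \<noteq> 2 * m"
      then have "a < 2 * m" using a by simp
      then show False using inner_neighbours a out by blast
    qed
    then have aw: "E (x (2 * m)) w" using a by simp
    have n0: "\<not> E (x 0) (x (2 * m + 1))" using tail_vertex_neighbours[OF _ N1 aw] out by blast
    have n1: "i \<noteq> 2 * m - 1"
    proof
      assume "i = 2 * m - 1"
      then have t: "E (y 0) (y (2 * m + 1))" using iE m unfolding flip_def by simp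
      have yw: "E (y (2 * m)) w" using aw unfolding flip_def by simp
      obtain j where j: "j \<le> N" "j \<le> 2 * m + 1" "w = y j" using flp.tail_vertex_neighbours[OF t N1 yw] by blast
      have "\<exists>j\<le>N. j \<le> 2 * m + 1 \<and> w = x j"
      proof (cases "j < 2 * m")
        case True
        then show ?thesis using j m unfolding flip_def by (intro exI[of _ "2 * m - 1 - j"]) auto
      next
        case False
        then show ?thesis using j unfolding flip_def by auto
      qed
      then show False using out by blast
    qed
    have adj: "E (x 0) (x s)" if "1 \<le> s" "s \<le> 2 * m" for s
      using missing(2)[OF that] n0 by blast
    have i2: "0 < i" "i + 2 \<le> 2 * m" using iE n0 n1 i by (cases i; simp)+
    have s1: "E (x (i + 1)) (x 0)" "E (x (i + 2)) (x 0)" using adj[of "i + 1"] adj[of "i + 2"] i2 E_sym by auto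
    \<comment> \<open>Both lists lead from \<open>2 * m\<close> to \<open>2 * m + 1\<close> by way
      of the edge at \<open>x i\<close>; the second omits \<open>i + 1\<close>.\<close>
    have "\<exists>j\<le>N. j \<le> 2 * m + 1 \<and> w = x j"
      by (rule exit_bound[where b = "2 * m + 1" and a = "2 * m" and p = "seg (2 * m) (i + 1) @ seg 0 i @ [2 * m + 1]"
            and q = "seg (2 * m) (i + 2) @ seg 0 i @ [2 * m + 1]"])
         (use N1 i2 s1 iE aw in \<open>auto simp: walk_simps idx_walk_seg[OF path]\<close>)
    then show False using out by blast
  qed
  then have "card V \<le> card (x ` {..2 * m + 1})" by (intro card_mono) auto
  also have "\<dots> \<le> 2 * m + 2" using card_image_le[of "{..2 * m + 1}" x] by simp
  finally show ?thesis unfolding config_full(3) .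
qed

end

section \<open>Odd ears of an even cycle\<close>

text \<open>The sums with \<open>Min W\<close> and the sums with \<open>Max U\<close> have only
  \<open>Max U + Min W\<close> in common.\<close>

lemma sumset_card:
  fixes U W :: "nat set"
  assumes "finite U" "finite W" "U \<noteq> {}" "W \<noteq> {}"
  shows "card U + card W \<le> card ((\<lambda>(u, w). u + w) ` (U \<times> W)) + 1"
proof -
  let ?S = "(\<lambda>(u, w). u + w) ` (U \<times> W)"
  let ?P = "(\<lambda>u. u + Min W) ` U" and ?Q = "(\<lambda>w. Max U + w) ` W"
  have fin: "finite ?S" "finite ?P" "finite ?Q" using assms by auto
  have mem: "Min W \<in> W" "Max U \<in> U" using assms by auto
  have sub: "?P \<union> ?Q \<subseteq> ?S" using mem by auto
  have "?P \<inter> ?Q \<subseteq> {Max U + Min W}"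
  proof
    fix z assume "z \<in> ?P \<inter> ?Q"
    then obtain u w where z: "u \<in> U" "w \<in> W" "z = u + Min W" "z = Max U + w" by auto
    then have "u \<le> Max U" "Min W \<le> w" using assms by auto
    then show "z \<in> {Max U + Min W}" using z by auto
  qed
  then have "card (?P \<inter> ?Q) \<le> 1" using card_mono[of "{Max U + Min W}"] by auto
  moreover have "card ?P = card U" "card ?Q = card W" by (auto intro!: card_image simp: inj_on_def)
  moreover have "card ?P + card ?Q = card (?P \<union> ?Q) + card (?P \<inter> ?Q)" using fin by (intro card_Un_Int) auto
  moreover have "card (?P \<union> ?Q) \<le> card ?S" using sub fin by (intro card_mono) auto
  ultimately show ?thesis by linarith
qed

text \<open>Different \<open>s\<close> and \<open>t\<close> would give four values. The lemma
  compares the gaps of chord pairs at the two ends of an ear.\<close>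

lemma three_values:
  fixes X :: "int set"
  assumes X: "finite X" "card X \<le> 3" and m: "M \<in> X" "M - s \<in> X" "M - t \<in> X" "M - s - t \<in> X" and p: "0 < s" "0 < t"
  shows "s = t" "X = {M, M - t, M - 2 * t}"
proof -
  show st: "s = t"
  proof (rule ccontr)
    assume "s \<noteq> t"
    then have "card {M, M - s, M - t, M - s - t} = 4" using p by auto
    moreover have "card {M, M - s, M - t, M - s - t} \<le> card X" using X(1) m by (intro card_mono) auto
    ultimately show False using X(2) by simp
  qed
  have sub: "{M, M - t, M - 2 * t} \<subseteq> X" using m st by auto
  have "card {M, M - t, M - 2 * t} = 3" using p by auto
  then show "X = {M, M - t, M - 2 * t}" using card_seteq[OF X(1) sub] X(2) by simp
qed

context ugraph
begin

lemma upath_rev: "upath (rev p) \<longleftrightarrow> upath p"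
  unfolding upath_def by simp

lemma ear_cycle:
  assumes x: "idx_path x N" and r: "r \<le> N"
    and ear: "upath (x i # q @ [x j])" "set q \<inter> x ` {..r} = {}"
    and p: "distinct p" "set p \<subseteq> {..r}" "hd p = j" "last p = i" "idx_walk x p" and ne: "p \<noteq> []" and ij: "i \<noteq> j"
    and l: "odd l" "l = length q + length p"
  shows "l \<in> odd_lengths"
proof -
  have lp: "2 \<le> length p"
  proof (rule ccontr)
    assume "\<not> 2 \<le> length p"
    then obtain a where "p = [a]" using ne by (cases p) (auto simp: Suc_le_eq)
    then show False using p ij by simp
  qed
  have inj: "inj_on x {..r}" using idx_pathD(1)[OF x] r by (auto intro: inj_on_subset)
  have e: "distinct q" "successively E (x i # q @ [x j])" using ear(1) unfolding upath_def by auto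
  have "distinct (map x p @ q)"
    using p(1,2) e(1) ear(2) inj by (auto simp: distinct_map intro: inj_on_subset)
  moreover have sp: "successively E (map x p)" using p(5) by (simp add: successively_map)
  have h: "hd (map x p) = x j" "last (map x p) = x i" using p(3,4) ne by (simp_all add: hd_map last_map)
  have "successively E (map x p @ q) \<and> E (last (map x p @ q)) (hd (map x p @ q))"
  proof (cases "q = []")
    case True
    then show ?thesis using sp h e(2) by simp
  next
    case False
    then have "E (x i) (hd q)" "successively E q" "E (last q) (x j)"
      using e(2) by (simp_all add: successively_append_iff successively_Cons)
    then show ?thesis using sp h ne False by (simp add: successively_append_iff)
  qed
  moreover have "3 \<le> length (map x p @ q)"
  proof (cases "q = []")
    case True
    then have "odd (length p)" using l by simp
    then have "length p \<noteq> 2" by auto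
    then show ?thesis using lp by simp
  next
    case False
    then have "0 < length q" by blast
    then show ?thesis using lp unfolding length_append length_map by linarith
  qed
  ultimately have "ucycle (map x p @ q)" unfolding ucycle_def by blast
  moreover have "length (map x p @ q) = l" using l by simp
  ultimately show ?thesis unfolding odd_lengths_def using l(1) by blast
qed

end

section \<open>Odd cycles through an odd ear\<close>

context few_odd_cycles
begin

context
  fixes x :: "nat \<Rightarrow> 'a" and N r i j :: nat and q :: "'a list"
  assumes lp: "longest_path x N" and r: "r \<le> N" "0 < r" "E (x 0) (x r)"
    and odds: "\<And>s. s \<le> N \<Longrightarrow> E (x 0) (x s) \<Longrightarrow> odd s \<and> s \<le> r"
    and ij: "i < j" "j \<le> r" and ear: "upath (x i # q @ [x j])" "set q \<inter> x ` {..r} = {}"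
    and parity: "(even i \<longleftrightarrow> even j) \<longleftrightarrow> even (length q)"
begin

lemma ear_path: "idx_path x N"
  using lp unfolding longest_path_def by blast

text \<open>All neighbours of \<open>x 0\<close> lie on the even cycle at odd positions, so an ear
  from \<open>x 0\<close> would be a single chord, and such a chord respects the colours.\<close>

lemma ear_start_pos: "0 < i"
proof (rule ccontr)
  assume "\<not> 0 < i"
  then have i0: "i = 0" by simp
  have s: "successively E (x 0 # q @ [x j])" using ear(1) unfolding upath_def i0 by blast
  show False
  proof (cases q)
    case Nil
    then have "E (x 0) (x j)" using s by simp
    then have "odd j" using odds ij r by force
    then show False using parity Nil i0 by simp
  next
    case (Cons h q')
    then have "E (x 0) h" using s by simp
    then obtain s where "s \<le> N" "h = x s" "E (x 0) (x s)"
      using longest_path_neighbours[OF lp] r by force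
    then have "h \<in> x ` {..r}" using odds by blast
    then show False using ear(2) Cons by auto
  qed
qed

text \<open>
  The chord to \<open>x s\<close> is followed towards the end \<open>x i\<close> of the ear and the chord to \<open>x t\<close> towards \<open>x j\<close>.
\<close>

lemma two_chord_ear:
  assumes s: "E (x 0) (x s)" "s \<le> N" "0 < s" and t: "E (x 0) (x t)" "t \<le> N" "0 < t"
    and d: "max s i < min t j"
  shows "length q + 3 + ((i - s) + (s - i)) + ((t - j) + (j - t)) \<in> odd_lengths"
proof (rule ear_cycle[OF ear_path r(1) ear, where p = "seg j t @ 0 # seg s i"])
  have o: "odd s" "s \<le> r" "odd t" "t \<le> r" using odds s t by blast+
  show "i \<noteq> j" using ij by simp
  show "odd (length q + 3 + ((i - s) + (s - i)) + ((t - j) + (j - t)))"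
  proof -
    have "even ((i - s) + (s - i)) \<longleftrightarrow> odd i" using o(1) by (cases "i \<le> s") auto
    moreover have "even ((t - j) + (j - t)) \<longleftrightarrow> odd j" using o(3) by (cases "j \<le> t") auto
    ultimately show ?thesis using parity by auto
  qed
  show "length q + 3 + ((i - s) + (s - i)) + ((t - j) + (j - t)) = length q + length (seg j t @ 0 # seg s i)" by simp
  have A: "set (seg j t) = {min j t..max j t}" "set (seg s i) = {min s i..max s i}" by simp_all
  show "distinct (seg j t @ 0 # seg s i)"
    unfolding distinct_append distinct.simps set_simps A using d s(3) t(3) ear_start_pos by auto
  show "set (seg j t @ 0 # seg s i) \<subseteq> {..r}"
    unfolding set_append set_simps A using o ij by auto
  show "idx_walk x (seg j t @ 0 # seg s i)"
    using s t o ij r E_sym[OF t(1)] by (simp add: walk_simps idx_walk_seg[OF ear_path])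
qed simp_all

lemma plain_ear: "length q + (j - i) + 1 \<in> odd_lengths"
  by (rule ear_cycle[OF ear_path r(1) ear, where p = "seg j i"])
     (use ij r parity in \<open>auto simp: idx_walk_seg[OF ear_path]\<close>)

text \<open>
  Split the neighbours of \<open>x 0\<close> into those up to \<open>i\<close>, strictly between \<open>i\<close> and \<open>j\<close>, and from
  \<open>j\<close> on. Any two nonempty parts of sizes \<open>a\<close> and \<open>b\<close> give at least \<open>a + b - 1\<close> lengths. For
  \<open>k = 3\<close> all three parts are pairs, with the same gap 2.
\<close>

lemma ear_exact:
  "k = 3 \<and> E (x 0) (x 3) \<and> E (x 0) (x (r - 2)) \<and> 3 < i \<and> j + 2 \<le> r \<and>
    (\<exists>b. E (x 0) (x b) \<and> i < b \<and> b < j \<and> b + 1 = 2 * i) \<and> (\<forall>l\<in>odd_lengths. l \<le> length q + 2 + i + (r - j))"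
proof -
  define S where "S = {s. 0 < s \<and> s \<le> N \<and> E (x 0) (x s)}"
  define A where "A = {s \<in> S. s \<le> i}"
  define B where "B = {s \<in> S. i < s \<and> s < j}"
  define C where "C = {s \<in> S. j \<le> s}"
  have N0: "0 < N" using r by simp
  have fS: "finite S" unfolding S_def by simp
  then have fin: "finite A" "finite B" "finite C" unfolding A_def B_def C_def by simp_all
  have SE: "E (x 0) (x s)" "s \<le> N" "0 < s" "s \<le> r" if "s \<in> S" for s using that odds unfolding S_def by auto
  have "{u. E (x 0) u} \<subseteq> x ` S"
    using longest_path_neighbours[OF lp N0] unfolding S_def by blast
  then have "card {u. E (x 0) u} \<le> card (x ` S)" using fS by (intro card_mono) auto
  also have "\<dots> \<le> card S" using fS by (rule card_image_le)
  finally have "2 * k \<le> card S" using degree[OF E_V[OF r(3)]] by linarith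
  also have "S = A \<union> B \<union> C" unfolding A_def B_def C_def using ij by auto
  also have "card (A \<union> B \<union> C) \<le> card A + card B + card C"
    using card_Un_le[of "A \<union> B" C] card_Un_le[of A B] by linarith
  finally have tot: "2 * k \<le> card A + card B + card C" .
  have A1: "1 \<in> A" using idx_pathD(2)[OF ear_path, of 0] N0 ear_start_pos unfolding A_def S_def by simp
  have Cr: "r \<in> C" using r ij unfolding C_def S_def by simp
  \<comment> \<open>On a class that lies on one side of an end of the ear, the distance to that end
    is injective; the lengths obtained are a shifted sumset of two sets of distances.\<close>
  have pair: "card U + card W \<le> k + 1"
    if UW: "finite U" "finite W" "U \<noteq> {}" "W \<noteq> {}" "\<And>u. u \<in> U \<Longrightarrow> u \<in> S" "\<And>w. w \<in> W \<Longrightarrow> w \<in> S"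
      and d: "\<And>u w. u \<in> U \<Longrightarrow> w \<in> W \<Longrightarrow> max u i < min w j"
      and side: "(\<forall>u\<in>U. u \<le> i) \<or> (\<forall>u\<in>U. i \<le> u)" "(\<forall>w\<in>W. w \<le> j) \<or> (\<forall>w\<in>W. j \<le> w)" for U W
  proof -
    let ?f = "\<lambda>u. (i - u) + (u - i)" and ?g = "\<lambda>w. (w - j) + (j - w)"
    have cf: "card (?f ` U) = card U"
    proof (intro card_image inj_onI)
      fix a b assume ab: "a \<in> U" "b \<in> U" "?f a = ?f b"
      then have "a \<le> i \<and> b \<le> i \<or> i \<le> a \<and> i \<le> b" using side(1) by blast
      then show "a = b" using ab(3) by arith
    qed
    have cg: "card (?g ` W) = card W"
    proof (intro card_image inj_onI)
      fix a b assume ab: "a \<in> W" "b \<in> W" "?g a = ?g b"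
      then have "a \<le> j \<and> b \<le> j \<or> j \<le> a \<and> j \<le> b" using side(2) by blast
      then show "a = b" using ab(3) by arith
    qed
    have "(\<lambda>t. length q + 3 + t) ` ((\<lambda>(u, w). u + w) ` (?f ` U \<times> ?g ` W)) \<subseteq> odd_lengths"
    proof
      fix l assume "l \<in> (\<lambda>t. length q + 3 + t) ` ((\<lambda>(u, w). u + w) ` (?f ` U \<times> ?g ` W))"
      then obtain u w where uw: "u \<in> U" "w \<in> W" "l = length q + 3 + (?f u + ?g w)" by auto
      have "length q + 3 + ?f u + ?g w \<in> odd_lengths"
        using two_chord_ear[of u w] SE[OF UW(5)[OF uw(1)]] SE[OF UW(6)[OF uw(2)]] d[OF uw(1,2)] by blast
      then show "l \<in> odd_lengths" using uw(3) by (simp add: add.assoc)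
    qed
    then have "card ((\<lambda>t. length q + 3 + t) ` ((\<lambda>(u, w). u + w) ` (?f ` U \<times> ?g ` W))) \<le> card odd_lengths"
      by (rule card_mono[OF finite_odd_lengths])
    then have "card ((\<lambda>(u, w). u + w) ` (?f ` U \<times> ?g ` W)) \<le> k"
      using few by (subst (asm) card_image) (auto simp: inj_on_def)
    then show ?thesis using sumset_card[of "?f ` U" "?g ` W"] UW(1-4) cf cg by simp
  qed
  have AC: "card A + card C \<le> k + 1"
    by (rule pair) (use fin A1 Cr ij in \<open>auto simp: A_def C_def\<close>)
  have "B \<noteq> {}"
  proof
    assume "B = {}"
    then show False using tot AC k3 by simp
  qed
  have AB: "card A + card B \<le> k + 1"
    by (rule pair) (use fin A1 \<open>B \<noteq> {}\<close> ij in \<open>auto simp: A_def B_def\<close>)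
  have BC: "card B + card C \<le> k + 1"
    by (rule pair) (use fin Cr \<open>B \<noteq> {}\<close> ij in \<open>auto simp: B_def C_def\<close>)
  \<comment> \<open>Adding the three bounds gives \<open>4 * k \<le> 3 * (k + 1)\<close>.\<close>
  have k: "k = 3" using tot AC AB BC k3 by linarith
  have two: "card A = 2" "card B = 2" "card C = 2" using tot AC AB BC unfolding k by linarith+
  obtain a where a: "A = {1, a}" "a \<noteq> 1" using two(1) A1 unfolding card_2_iff by fastforce
  obtain c where c: "C = {c, r}" "c \<noteq> r" using two(3) Cr unfolding card_2_iff by fastforce
  obtain b b' where b: "B = {b, b'}" "b < b'" using two(2) unfolding card_2_iff by (metis insert_commute nat_neq_iff)
  have mA: "a \<in> S" "1 < a" "a \<le> i" using a SE(3) unfolding A_def by fastforce+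
  have mC: "c \<in> S" "c < r" "j \<le> c" using c SE(4) unfolding C_def by (fastforce simp: le_less)+
  have mB: "b \<in> S" "b' \<in> S" "i < b" "b' < j" using b unfolding B_def by auto
  have S1: "1 \<in> S" "r \<in> S" using A1 Cr unfolding A_def C_def by auto
  define X where "X = int ` odd_lengths"
  have X: "finite X" "card X \<le> 3"
    unfolding X_def using finite_odd_lengths few k by (simp_all add: card_image)
  define K where "K = int (length q) + 3"
  have chord: "K + \<bar>int i - int s\<bar> + \<bar>int t - int j\<bar> \<in> X" if "s \<in> S" "t \<in> S" "max s i < min t j" for s t
  proof -
    have "length q + 3 + ((i - s) + (s - i)) + ((t - j) + (j - t)) \<in> odd_lengths"
      using two_chord_ear SE that by blast
    moreover have "int (length q + 3 + ((i - s) + (s - i)) + ((t - j) + (j - t))) = K + \<bar>int i - int s\<bar> + \<bar>int t - int j\<bar>"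
      unfolding K_def by auto
    ultimately show ?thesis unfolding X_def by (metis imageI)
  qed
  define M where "M = K + (int i - 1) + (int r - int j)"
  define t where "t = int r - int c"
  have ac: "M \<in> X" "M - (int a - 1) \<in> X" "M - t \<in> X" "M - (int a - 1) - t \<in> X"
    using chord[OF S1] chord[OF mA(1) S1(2)] chord[OF S1(1) mC(1)] chord[OF mA(1) mC(1)] mA mC ij
    unfolding M_def t_def by (simp_all add: algebra_simps)
  have t0: "0 < t" "0 < int a - 1" using mC mA unfolding t_def by auto
  \<comment> \<open>Two choices at each end give four sums with only three values available, so the
    gaps agree and \<open>X\<close> is an arithmetic progression.\<close>
  note ac' = three_values[OF X ac t0(2,1)]
  define M' where "M' = K + (int i - 1) + (int j - int b)"
  have ab: "M' \<in> X" "M' - (int a - 1) \<in> X" "M' - (int b' - int b) \<in> X" "M' - (int a - 1) - (int b' - int b) \<in> X"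
    using chord[OF S1(1) mB(1)] chord[OF mA(1) mB(1)] chord[OF S1(1) mB(2)] chord[OF mA(1) mB(2)] mA mB b(2) ij
    unfolding M'_def by (simp_all add: algebra_simps)
  have tb: "0 < int b' - int b" using b by simp
  note ab' = three_values[OF X ab t0(2) tb]
  define M'' where "M'' = K + (int b' - int i) + (int r - int j)"
  have bc: "M'' \<in> X" "M'' - (int b' - int b) \<in> X" "M'' - t \<in> X" "M'' - (int b' - int b) - t \<in> X"
    using chord[OF mB(2) S1(2)] chord[OF mB(1) S1(2)] chord[OF mB(2) mC(1)] chord[OF mB(1) mC(1)] mC mB b(2) ij
    unfolding M''_def t_def by (simp_all add: algebra_simps)
  note bc' = three_values[OF X bc tb t0(1)]
  have bt: "int b' - int b = t" using bc'(1) .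
  have at: "int a - 1 = t" using ac'(1) .
  have XM: "z \<le> M" "z \<in> {M, M - t, M - 2 * t}" if "z \<in> X" for z using that t0(1) unfolding ac'(2) by auto
  have "M \<in> {M', M' - t, M' - 2 * t}" "M \<in> {M'', M'' - t, M'' - 2 * t}"
    using ac(1) ab'(2) bc'(2) bt by auto
  then have "M \<le> M'" "M \<le> M''" using t0(1) by auto
  \<comment> \<open>All three progressions are the set \<open>X\<close>, so their largest elements
    coincide.\<close>
  then have MM: "M' = M" "M'' = M" using XM(1)[OF ab(1)] XM(1)[OF bc(1)] by auto
  have e1: "int r - int j = int j - int b" using MM(1) unfolding M_def M'_def by simp
  have e2: "int b' - int i = int i - 1" using MM(2) unfolding M_def M''_def by simp
  \<comment> \<open>The ear closed by the stretch between its ends gives one more length, and this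
    fits into the progression only if the gap is 2.\<close>
  have "K + (int j - int i) - 2 \<in> X"
  proof -
    have "int (length q + (j - i) + 1) \<in> X" unfolding X_def using plain_ear by blast
    moreover have "int (length q + (j - i) + 1) = K + (int j - int i) - 2" unfolding K_def using ij by simp
    ultimately show ?thesis by metis
  qed
  moreover have "K + (int j - int i) - 2 = M - t - 2" unfolding M_def using e1 e2 bt by simp
  ultimately have "M - t - 2 \<in> X" by simp
  then have "M - t - 2 \<in> {M, M - t, M - 2 * t}" by (rule XM(2))
  then have t2: "t = 2" using t0(1) by auto
  have "a = 3" "c = r - 2" "j + 2 \<le> r" using at t2 mC unfolding t_def by auto
  moreover have "3 < i" using e2 bt t2 mB(3) by linarith
  moreover have "b' + 1 = 2 * i" using e2 by linarith
  moreover have "i < b'" using mB b by simp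
  moreover have "l \<le> length q + 2 + i + (r - j)" if "l \<in> odd_lengths" for l
  proof -
    have "int l \<le> M" using XM(1) that unfolding X_def by blast
    then show ?thesis unfolding M_def K_def using ij by linarith
  qed
  ultimately show ?thesis using k mA(1) mC(1) mB SE(1) by blast
qed

end

text \<open>The tight configuration also occurs after rotation along the chord to
  \<open>x r\<close>, where the chord to position \<open>r - 2\<close> is an edge from
  \<open>x (r - 1)\<close> to \<open>x 1\<close> of the original path. This edge gives a cycle two
  longer than the largest odd length.\<close>

lemma ear_False:
  assumes lp: "longest_path x N" and r: "r \<le> N" "0 < r" "E (x 0) (x r)"
    and odds: "\<And>x' s. longest_path x' N \<Longrightarrow> s \<le> N \<Longrightarrow> E (x' 0) (x' s) \<Longrightarrow> odd s \<and> s \<le> r"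
    and ij: "i < j" "j \<le> r" and ear: "upath (x i # q @ [x j])" "set q \<inter> x ` {..r} = {}"
    and parity: "(even i \<longleftrightarrow> even j) \<longleftrightarrow> even (length q)"
  shows False
proof -
  have path: "idx_path x N" using lp unfolding longest_path_def by blast
  have ro: "odd r" using odds[OF lp r(1,3)] by blast
  from ear_exact[OF lp r odds[OF lp] ij ear parity]
  have k: "E (x 0) (x 3)" "3 < i" "j + 2 \<le> r" and le: "\<And>l. l \<in> odd_lengths \<Longrightarrow> l \<le> length q + 2 + i + (r - j)"
    and "\<exists>b. E (x 0) (x b) \<and> i < b \<and> b < j \<and> b + 1 = 2 * i" by blast+
  then obtain b where b: "E (x 0) (x b)" "i < b" "b < j" "b + 1 = 2 * i" by blast
  define x' where "x' s = (if s < r then x (r - 1 - s) else x s)" for s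
  have lp': "longest_path x' N"
    using idx_path_rotate[OF path r(3,2,1)] lp unfolding longest_path_def x'_def[abs_def] by blast
  have img: "x' ` {..r} = x ` {..r}"
  proof
    show "x' ` {..r} \<subseteq> x ` {..r}" unfolding x'_def by auto
    show "x ` {..r} \<subseteq> x' ` {..r}"
    proof
      fix v assume "v \<in> x ` {..r}"
      then obtain s where s: "s \<le> r" "v = x s" by blast
      show "v \<in> x' ` {..r}"
      proof (cases "s < r")
        case True
        then have "v = x' (r - 1 - s)" using s unfolding x'_def by simp
        then show ?thesis by auto
      next
        case False
        then have "v = x' s" using s unfolding x'_def by simp
        then show ?thesis using s by blast
      qed
    qed
  qed
  have r': "E (x' 0) (x' r)" using idx_pathD(3)[OF path, of r] r unfolding x'_def by simp
  have xi: "x' (r - 1 - i) = x i" "x' (r - 1 - j) = x j" using ij k r unfolding x'_def by simp_all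
  have "upath (rev (x i # q @ [x j]))" using ear(1) unfolding upath_rev .
  then have ear': "upath (x' (r - 1 - j) # rev q @ [x' (r - 1 - i)])" unfolding xi by simp
  have dis': "set (rev q) \<inter> x' ` {..r} = {}" unfolding img using ear(2) by simp
  have par': "(even (r - 1 - j) \<longleftrightarrow> even (r - 1 - i)) \<longleftrightarrow> even (length (rev q))"
    using parity ro ij k(3) by auto
  have ij': "r - 1 - j < r - 1 - i" "r - 1 - i \<le> r" using ij k(3) by auto
  have "E (x' 0) (x' (r - 2))" using ear_exact[OF lp' r(1,2) r' odds[OF lp'] ij' ear' dis' par'] by blast
  then have y1: "E (x (r - 1)) (x 1)" using k r unfolding x'_def by simp
  define l where "l = length q + 4 + i + (r - j)"
  have lo: "odd l"
  proof -
    have "odd (r - j) \<longleftrightarrow> even j" using ro k(3) by simp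
    then show ?thesis unfolding l_def using parity by auto
  qed
  have "l \<in> odd_lengths"
  \<comment> \<open>Because of \<open>b + 1 = 2 * i\<close> the last stretch has exactly
    \<open>i\<close> vertices.\<close>
  proof (rule ear_cycle[OF path r(1) ear, where p = "seg j (r - 2) @ (r - 1) # seg 1 3 @ 0 # seg b i"])
    have A: "set (seg j (r - 2)) = {j..r - 2}" "set (seg 1 3) = {1..3}" "set (seg b i) = {i..b}"
      using k b by auto
    show "distinct (seg j (r - 2) @ (r - 1) # seg 1 3 @ 0 # seg b i)"
      unfolding distinct_append distinct.simps set_simps set_append A using k b by auto
    show "set (seg j (r - 2) @ (r - 1) # seg 1 3 @ 0 # seg b i) \<subseteq> {..r}"
      unfolding set_append set_simps A using k b ij by auto
    have "E (x (r - 2)) (x (r - 1))" using idx_pathD(3)[OF path, of "r - 1"] k r by (simp add: numeral_2_eq_2)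
    then show "idx_walk x (seg j (r - 2) @ (r - 1) # seg 1 3 @ 0 # seg b i)"
      using k b ij r y1 E_sym[OF k(1)] by (simp add: walk_simps idx_walk_seg[OF path])
    show "l = length q + length (seg j (r - 2) @ (r - 1) # seg 1 3 @ 0 # seg b i)"
      unfolding l_def using k b ij by simp
  qed (use ij lo in simp_all)
  then show False using le[of l] unfolding l_def by simp
qed

lemma odd_lengths_initial_segment:
  assumes nb: "\<And>c :: 'a \<Rightarrow> bool. \<exists>u v. E u v \<and> c u = c v"
  shows "odd_lengths = {l. odd l \<and> 3 \<le> l \<and> l \<le> 2 * k + 1} \<and> card V \<le> 2 * k + 2"
proof -
  have bound: "length p \<le> card V" if "upath p" for p
    using that card_mono[OF finite_V, of "set p"] distinct_card[of p] unfolding upath_def by auto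
  obtain u v where uv: "E u v" using nb[of "\<lambda>_. True"] by blast
  have uvp: "upath [u, v]" using uv E_V E_V2 E_irrefl unfolding upath_def by auto
  obtain p where p: "upath p" "\<And>p'. upath p' \<Longrightarrow> length p' \<le> length p"
    using ex_has_greatest_nat[of upath "[u, v]" length "Suc (card V)"] uvp bound by (meson le_imp_less_Suc)
  have lenp: "2 \<le> length p" using p(2)[OF uvp] by simp
  define N where "N = length p - 1"
  have N: "Suc N = length p" "0 < N" using lenp unfolding N_def by auto
  have lp0: "longest_path (\<lambda>i. p ! i) N"
    unfolding longest_path_def idx_path_def
  proof (intro conjI allI impI)
    show "inj_on ((!) p) {..N}"
      using p(1) N unfolding upath_def inj_on_def by (auto simp: nth_eq_iff_index_eq less_Suc_eq_le)
    show "E (p ! i) (p ! Suc i)" if "i < N" for i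
      using p(1) N that unfolding upath_def by (simp add: successively_conv_nth)
    show "length p' \<le> Suc N" if "upath p'" for p' using p(2)[OF that] N by simp
  qed
  \<comment> \<open>The maximum is taken over the starts of all longest paths at once; both
    \<open>even_config\<close> and \<open>ear_False\<close> rely on this.\<close>
  define ends where "ends P s \<longleftrightarrow> (\<exists>x. longest_path x N \<and> s \<le> N \<and> 0 < s \<and> E (x 0) (x s) \<and> P s)" for P s
  have max_end: "\<exists>s. ends P s \<and> (\<forall>t. ends P t \<longrightarrow> t \<le> s)" if "ends P s" for P s
    using Nat.ex_has_greatest_nat[of "ends P" s N] that unfolding ends_def by blast
  show ?thesis
  proof (cases "\<exists>s. ends even s")
    case True
    then obtain e where e: "ends even e" "\<And>t. ends even t \<Longrightarrow> t \<le> e" using max_end by blast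
    then obtain x where x: "longest_path x N" "e \<le> N" "0 < e" "E (x 0) (x e)" "even e" unfolding ends_def by blast
    then obtain m where m: "e = 2 * m" by (elim evenE)
    interpret even_config V E k x N m
    proof unfold_locales
      show "s \<le> 2 * m" if "longest_path x' N" "s \<le> N" "even s" "E (x' 0) (x' s)" for x' s
      proof -
        have "s \<noteq> 0" using that(4) E_irrefl by metis
        then have "ends even s" unfolding ends_def using that by blast
        then show ?thesis using e(2) m by simp
      qed
    qed (use x m in auto)
    show ?thesis using odd_lengths_eq few_vertices by blast
  next
    case False
    have "ends (\<lambda>_. True) 1"
      unfolding ends_def using lp0 N idx_pathD(2)[of "(!) p" N 0] unfolding longest_path_def by auto
    then obtain r where r: "ends (\<lambda>_. True) r" "\<And>t. ends (\<lambda>_. True) t \<Longrightarrow> t \<le> r" using max_end by blast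
    then obtain x where x: "longest_path x N" "r \<le> N" "0 < r" "E (x 0) (x r)" unfolding ends_def by blast
    have path: "idx_path x N" using x(1) unfolding longest_path_def by blast
    have odds: "odd s \<and> s \<le> r" if "longest_path x' N" "s \<le> N" "E (x' 0) (x' s)" for x' s
    proof -
      have "s \<noteq> 0" using that(3) E_irrefl by metis
      then have "ends (\<lambda>_. True) s" "even s \<Longrightarrow> ends even s" unfolding ends_def using that by blast+
      then show ?thesis using r(2) False by blast
    qed
    define C where "C = x ` {..r}"
    define c where "c w \<longleftrightarrow> even (inv_into {..N} x w)" for w
    have inj: "inj_on x {..N}" using idx_pathD(1)[OF path] .
    have c: "c (x s) \<longleftrightarrow> even s" if "s \<le> N" for s
      unfolding c_def using inv_into_f_f[OF inj, of s] that by simp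
    have "C \<subseteq> V"
    proof
      fix w assume "w \<in> C"
      then obtain s where s: "s \<le> r" "w = x s" unfolding C_def by blast
      show "w \<in> V"
      proof (cases "s = 0")
        case True then show ?thesis using s x(4) E_V by simp
      next
        case False then show ?thesis using s x(2) idx_pathD(3)[OF path, of s] E_V2 by simp
      qed
    qed
    moreover have "x 0 \<in> C" "x r \<in> C" unfolding C_def by auto
    moreover have "x 0 \<noteq> x r" using x(4) E_irrefl by metis
    ultimately have "odd_ear C c" using odd_ear_exists nb by blast
    then obtain u v q where q: "u \<in> C" "v \<in> C" "u \<noteq> v" "upath (u # q @ [v])" "set q \<inter> C = {}"
      "c u = c v \<longleftrightarrow> even (length q)" unfolding odd_ear_def by blast
    obtain i j where ij: "i \<le> r" "u = x i" "j \<le> r" "v = x j" using q(1,2) unfolding C_def by blast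
    have cc: "(even i \<longleftrightarrow> even j) \<longleftrightarrow> even (length q)"
      using q(6) c[of i] c[of j] ij x(2) by simp
    consider "i < j" | "j < i" using q(3) ij by (metis nat_neq_iff)
    then have False
    proof cases
      case 1
      have ear: "upath (x i # q @ [x j])" "set q \<inter> x ` {..r} = {}" using q(4,5) ij unfolding C_def by simp_all
      show False by (rule ear_False[OF x _ 1 ij(3) ear cc]) (rule odds)
    next
      case 2
      have "upath (rev (u # q @ [v]))" using q(4) unfolding upath_rev .
      then have ear: "upath (x j # rev q @ [x i])" "set (rev q) \<inter> x ` {..r} = {}" using q(5) ij unfolding C_def by simp_all
      have cc': "(even j \<longleftrightarrow> even i) \<longleftrightarrow> even (length (rev q))" using cc by auto
      show False by (rule ear_False[OF x _ 2 ij(1) ear cc']) (rule odds)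
    qed
    then show ?thesis ..
  qed
qed

end

section \<open>Transfer to symmetric digraphs\<close>

lemma connected_cut:
  assumes G: "graph G" and c: "Digraph_Component.connected (G \<restriction> X)" and X: "X \<subseteq> verts G"
    and W: "W \<subseteq> X" "W \<noteq> {}" "X - W \<noteq> {}"
  shows "\<exists>u\<in>W. \<exists>v\<in>X - W. (u, v) \<in> arcs_ends G"
proof (rule ccontr)
  assume no: "\<not> ?thesis"
  obtain a b where ab: "a \<in> W" "b \<in> X - W" using W by blast
  have sym: "sym (arcs_ends G)"
    using G unfolding graph_def pseudo_graph_def sym_digraph_def sym_digraph_axioms_def symmetric_def by blast
  have "a \<in> X" "b \<in> X" using ab W by auto
  then have "(a, b) \<in> rtrancl_on X ((arcs_ends (G \<restriction> X))\<^sup>s)"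
    using c unfolding connected_conv by simp
  then have "b \<in> W"
  proof (induction rule: rtrancl_on_induct)
    case base
    show ?case by (rule ab(1))
  next
    case (step y z)
    have "(p, q) \<in> arcs_ends G" if "(p, q) \<in> arcs_ends (G \<restriction> X)" for p q
      using that by (rule dominates_induce_subgraphD)
    then have "(y, z) \<in> arcs_ends G"
      using step(2) sym unfolding symcl_def sym_def by auto
    then show ?case using no step W(1) by blast
  qed
  then show False using ab by blast
qed

locale simple_graph = graph G for G :: "('a, 'b) pre_digraph"
begin

definition adj :: "'a \<Rightarrow> 'a \<Rightarrow> bool" where
  "adj u v \<longleftrightarrow> (u, v) \<in> arcs_ends G"

sublocale ug: ugraph "verts G" adj
proof unfold_locales
  show "finite (verts G)" by simp
  show "adj v u" if "adj u v" for u v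
    using that arcs_ends_symmetric[OF sym_arcs] unfolding adj_def by blast
  show "\<not> adj u u" for u using adj_not_same unfolding adj_def by blast
  show "u \<in> verts G" if "adj u v" for u v
    using that unfolding adj_def arcs_ends_conv by auto
qed

lemma adjI: "e \<in> arcs G \<Longrightarrow> adj (tail G e) (head G e)"
  unfolding adj_def arcs_ends_conv by blast

lemma adjE:
  assumes "adj u v" obtains e where "e \<in> arcs G" "tail G e = u" "head G e = v"
  using assms unfolding adj_def arcs_ends_conv by blast

lemma awalk_verts_heads: "cas u p v \<Longrightarrow> awalk_verts u p = u # map (head G) p"
  by (induction p arbitrary: u) auto

lemma cas_successively:
  "cas u p v \<Longrightarrow> set p \<subseteq> arcs G \<Longrightarrow> successively adj (u # map (head G) p) \<and> last (u # map (head G) p) = v"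
proof (induction p arbitrary: u)
  case (Cons e p)
  then show ?case using adjI[of e] by auto
qed simp

lemma successively_cas:
  "successively adj (u # vs) \<Longrightarrow> \<exists>p. cas u p (last (u # vs)) \<and> set p \<subseteq> arcs G \<and> map (head G) p = vs"
proof (induction vs arbitrary: u)
  case Nil
  show ?case by (intro exI[of _ "[]"]) simp
next
  case (Cons w vs)
  then have "adj u w" "successively adj (w # vs)" by simp_all
  from this(1) obtain e where e: "e \<in> arcs G" "tail G e = u" "head G e = w" by (rule adjE)
  from Cons.IH[OF \<open>successively adj (w # vs)\<close>] obtain p where
    "cas w p (last (w # vs))" "set p \<subseteq> arcs G" "map (head G) p = vs" by blast
  then show ?case using e by (intro exI[of _ "e # p"]) auto
qed

text \<open>A cycle of arcs corresponds to the list of the heads of its arcs. Conversely, the closed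
  walk starts at the last vertex of the list.\<close>

lemma odd_cycle_lengths_eq: "odd_cycle_lengths G = ug.odd_lengths"
proof (intro set_eqI iffI)
  fix l assume "l \<in> odd_cycle_lengths G"
  then obtain p where l: "odd l" "3 \<le> l" "cycle p" "length p = l"
    unfolding odd_cycle_lengths_def cycle_of_length_def by blast
  then obtain u where u: "awalk u p u" "distinct (tl (awalk_verts u p))" unfolding cycle_def by blast
  have cas: "cas u p u" "set p \<subseteq> arcs G" using u(1) unfolding awalk_def by auto
  have ne: "p \<noteq> []" using l by auto
  let ?v = "map (head G) p"
  have s: "successively adj (u # ?v)" "last (u # ?v) = u" using cas_successively[OF cas] by auto
  then have "successively adj ?v" "adj (last ?v) (hd ?v)" using ne by (auto simp: successively_Cons)
  moreover have "distinct ?v" using u(2) unfolding awalk_verts_heads[OF cas(1)] by simp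
  ultimately have "ug.ucycle ?v" unfolding ug.ucycle_def using l by simp
  then show "l \<in> ug.odd_lengths" unfolding ug.odd_lengths_def using l by (auto intro!: exI[of _ ?v])
next
  fix l assume "l \<in> ug.odd_lengths"
  then obtain vs where l: "odd l" "length vs = l" "ug.ucycle vs" unfolding ug.odd_lengths_def by blast
  then have v: "3 \<le> l" "distinct vs" "successively adj vs" "adj (last vs) (hd vs)" unfolding ug.ucycle_def by auto
  have ne: "vs \<noteq> []" using v l by auto
  then have "successively adj (last vs # vs)" using v by (simp add: successively_Cons)
  from successively_cas[OF this] obtain p where
    p: "cas (last vs) p (last (last vs # vs))" "set p \<subseteq> arcs G" "map (head G) p = vs" by blast
  have "last vs \<in> verts G" using v(4) ug.E_V by blast
  then have "awalk (last vs) p (last vs)" unfolding awalk_def using p ne by simp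
  moreover have "distinct (tl (awalk_verts (last vs) p))" unfolding awalk_verts_heads[OF p(1)] using p(3) v(2) by simp
  moreover have "p \<noteq> []" using p(3) ne by auto
  ultimately have "cycle p" unfolding cycle_def by blast
  moreover have "length p = l" using p(3) l(2) by auto
  ultimately show "l \<in> odd_cycle_lengths G"
    unfolding odd_cycle_lengths_def cycle_of_length_def using l v by blast
qed

lemma out_degree_eq: "out_degree G v = card {u. adj v u}"
proof -
  have "{u. adj v u} = head G ` out_arcs G v"
    unfolding adj_def arcs_ends_conv out_arcs_def by auto
  moreover have "inj_on (head G) (out_arcs G v)"
    using no_multi_arcs unfolding inj_on_def out_arcs_def arc_to_ends_def by auto
  ultimately show ?thesis unfolding out_degree_def by (simp add: card_image)
qed

lemma degree_ge:
  assumes "d \<le> min_degree G" "v \<in> verts G" shows "d \<le> card {u. adj v u}"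
proof -
  have "min_degree G \<le> out_degree G v" unfolding min_degree_def using assms(2) by (intro Min_le) auto
  then show ?thesis using assms(1) unfolding out_degree_eq by simp
qed

lemma two_connectedI:
  assumes "k_connected 2 G"
  shows "two_connected_graph (verts G) adj"
proof unfold_locales
  have con: "Digraph_Component.connected (G \<restriction> (verts G - X))" if "X \<subseteq> verts G" "card X < 2" for X
    using assms that unfolding k_connected_def by blast
  show c0: "\<exists>u\<in>W. \<exists>v\<in>verts G - W. adj u v" if "W \<subseteq> verts G" "W \<noteq> {}" "verts G - W \<noteq> {}" for W
    using connected_cut[OF graph_axioms, of "verts G"] con[of "{}"] that unfolding adj_def by simp
  show "\<exists>u\<in>W. \<exists>v\<in>verts G - {z} - W. adj u v"
    if "W \<subseteq> verts G - {z}" "W \<noteq> {}" "verts G - {z} - W \<noteq> {}" for W z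
  proof (cases "z \<in> verts G")
    case True
    then show ?thesis
      using connected_cut[OF graph_axioms, of "verts G - {z}"] con[of "{z}"] that unfolding adj_def by simp
  next
    case False
    then show ?thesis using c0[of W] that by simp
  qed
qed

section \<open>Complete subgraphs and colourings of nearly complete graphs\<close>

lemma contains_completeI:
  assumes X: "X \<subseteq> verts G" "card X = n" and adj: "\<And>u v. u \<in> X \<Longrightarrow> v \<in> X \<Longrightarrow> u \<noteq> v \<Longrightarrow> adj u v"
  shows "contains_complete G n"
proof -
  let ?H = "G \<restriction> X"
  have sub: "subgraph ?H G" using subgraph_induce_subgraphI[OF X(1)] .
  have ends: "arcs_ends ?H = {(u, v). (u, v) \<in> X \<times> X \<and> u \<noteq> v}"
  proof (intro set_eqI iffI)
    fix e assume "e \<in> arcs_ends ?H"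
    then show "e \<in> {(u, v). (u, v) \<in> X \<times> X \<and> u \<noteq> v}"
      using no_loops unfolding arcs_ends_conv by auto
  next
    fix e assume "e \<in> {(u, v). (u, v) \<in> X \<times> X \<and> u \<noteq> v}"
    then obtain u v where e: "e = (u, v)" "u \<in> X" "v \<in> X" "u \<noteq> v" by blast
    then obtain a where "a \<in> arcs G" "tail G a = u" "head G a = v" using adj adjE by metis
    then show "e \<in> arcs_ends ?H" using e unfolding arcs_ends_conv by force
  qed
  interpret H: wf_digraph ?H by (rule wellformed_induce_subgraph)
  have "graph ?H"
  proof unfold_locales
    show "finite (verts ?H)" using finite_subset[OF X(1)] by simp
    show "finite (arcs ?H)" by simp
    show "tail ?H e \<noteq> head ?H e" if "e \<in> arcs ?H" for e using that no_loops by auto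
    show "e1 = e2" if "e1 \<in> arcs ?H" "e2 \<in> arcs ?H" "arc_to_ends ?H e1 = arc_to_ends ?H e2" for e1 e2
      using that no_multi_arcs by auto
    show "symmetric ?H" unfolding symmetric_def ends by (auto intro: symI)
  qed
  then have "complete_digraph n ?H" unfolding complete_digraph_def using X ends by simp
  then show ?thesis unfolding contains_complete_def using sub by blast
qed

lemma complete_or_colorable:
  assumes n: "card (verts G) = n + 1 \<or> card (verts G) = n + 2" and d: "n \<le> min_degree G" and n2: "2 \<le> n"
  shows "contains_complete G (n + 1) \<or> chromatic_number G \<le> n"
proof (cases "\<exists>a b c d. a \<in> verts G \<and> b \<in> verts G \<and> c \<in> verts G \<and> d \<in> verts G \<and> distinct [a, b, c, d] \<and> \<not> adj a b \<and> \<not> adj c d \<and> card (verts G) = n + 2")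
  case True
  then obtain a b c d where v: "a \<in> verts G" "b \<in> verts G" "c \<in> verts G" "d \<in> verts G" "distinct [a, b, c, d]"
    "\<not> adj a b" "\<not> adj c d" and cv: "card (verts G) = n + 2" by blast
  have "card (verts G - {a, b, c, d}) = n - 2"
    using v cv by (subst card_Diff_subset) auto
  then obtain f where f: "bij_betw f (verts G - {a, b, c, d}) {..<n - 2}"
    using ex_bij_betw_finite_nat[of "verts G - {a, b, c, d}"] by (auto simp: atLeast0LessThan)
  define col where "col w = (if w \<in> {a, b} then n - 2 else if w \<in> {c, d} then n - 1 else f w)" for w
  have fl: "f w < n - 2" if "w \<in> verts G - {a, b, c, d}" for w
    using f that unfolding bij_betw_def by blast
  have "proper_coloring G n col"
    unfolding proper_coloring_def
  proof (intro conjI ballI)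
    show "col w < n" if "w \<in> verts G" for w
      using fl[of w] that n2 unfolding col_def by auto
    fix e assume e: "e \<in> arcs_ends G"
    obtain u w where uw: "e = (u, w)" by (cases e)
    have A: "adj u w" "adj w u" using e uw ug.E_sym unfolding adj_def by blast+
    have V: "u \<in> verts G" "w \<in> verts G" using A ug.E_V by blast+
    have "u \<noteq> w" using A ug.E_irrefl by metis
    have "col u \<noteq> col w"
    proof (cases "u \<in> {a, b, c, d} \<or> w \<in> {a, b, c, d}")
      case True
      have ab: "\<not> (u \<in> {a, b} \<and> w \<in> {a, b})" "\<not> (u \<in> {c, d} \<and> w \<in> {c, d})"
        using A v(6,7) \<open>u \<noteq> w\<close> by auto
      then show ?thesis
        using True fl[of u] fl[of w] V n2 v(5) unfolding col_def by auto
    next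
      case False
      then have "col u = f u" "col w = f w" unfolding col_def by simp_all
      moreover have "f u \<noteq> f w"
        using inj_on_contraD[OF bij_betw_imp_inj_on[OF f] \<open>u \<noteq> w\<close>] V False by blast
      ultimately show ?thesis by simp
    qed
    then show "case e of (u, v) \<Rightarrow> col u \<noteq> col v" unfolding uw by simp
  qed
  then have "chromatic_number G \<le> n" unfolding chromatic_number_def by (intro Least_le) blast
  then show ?thesis ..
next
  case no: False
  \<comment> \<open>The degree leaves no non-neighbour among \<open>n + 1\<close> vertices, and at
    most one among \<open>n + 2\<close>.\<close>
  have bound: "card T + n + 1 \<le> card (verts G)" if "v \<in> verts G" "T \<subseteq> verts G - {v}" "\<And>u. u \<in> T \<Longrightarrow> \<not> adj v u" for v T
  proof -
    have fT: "finite T" using that(2) finite_subset by fastforce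
    have "n \<le> card {u. adj v u}" by (rule degree_ge[OF d that(1)])
    also have "\<dots> \<le> card (verts G - {v} - T)"
      using that(3) ug.E_V2 ug.E_irrefl by (intro card_mono) auto
    also have "\<dots> = card (verts G - {v}) - card T" using fT that(2) by (simp add: card_Diff_subset)
    also have "card (verts G - {v}) = card (verts G) - 1" using that(1) by simp
    finally have "n \<le> card (verts G) - 1 - card T" .
    then show ?thesis using n2 by linarith
  qed
  show ?thesis
  proof (cases "card (verts G) = n + 1")
    case True
    have "adj u v" if "u \<in> verts G" "v \<in> verts G" "u \<noteq> v" for u v
    proof (rule ccontr)
      assume "\<not> adj u v"
      then have "card {v} + n + 1 \<le> card (verts G)" using that by (intro bound[of u]) simp_all
      then show False using True by simp
    qed
    then show ?thesis using contains_completeI[OF subset_refl True] by blast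
  next
    case False
    then have cv: "card (verts G) = n + 2" using n by blast
    have "\<exists>a\<in>verts G. \<forall>u\<in>verts G - {a}. \<forall>v\<in>verts G - {a}. u \<noteq> v \<longrightarrow> adj u v"
    proof (cases "\<exists>a\<in>verts G. \<exists>b\<in>verts G. a \<noteq> b \<and> \<not> adj a b")
      case False
      moreover have "verts G \<noteq> {}" using cv by auto
      ultimately show ?thesis by blast
    next
      case True
      then obtain a b where ab: "a \<in> verts G" "b \<in> verts G" "a \<noteq> b" "\<not> adj a b" by blast
      \<comment> \<open>A second non-adjacent pair is either disjoint from the first, against
        \<open>no\<close>, or gives \<open>b\<close> two non-neighbours.\<close>
      have "adj u v" if uv: "u \<in> verts G - {a}" "v \<in> verts G - {a}" "u \<noteq> v" for u v
      proof (rule ccontr)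
        assume nuv: "\<not> adj u v"
        have two: False if "w \<in> verts G - {a, b}" "\<not> adj b w" for w
        proof -
          have "\<not> adj b a" using ab(4) ug.E_sym by blast
          then have "card {a, w} + n + 1 \<le> card (verts G)" using that ab by (intro bound[of b]) auto
          moreover have "card {a, w} = 2" using that(1) by auto
          ultimately show False using cv by simp
        qed
        have "u \<noteq> b" using two[of v] nuv uv by blast
        moreover have "v \<noteq> b" using two[of u] nuv uv ug.E_sym by blast
        ultimately have "distinct [a, b, u, v]" using ab(3) uv by auto
        moreover have "u \<in> verts G" "v \<in> verts G" using uv by simp_all
        ultimately show False using no ab nuv cv by blast
      qed
      then show ?thesis using ab(1) by blast
    qed
    then obtain a where a: "a \<in> verts G" "\<And>u v. u \<in> verts G - {a} \<Longrightarrow> v \<in> verts G - {a} \<Longrightarrow> u \<noteq> v \<Longrightarrow> adj u v" by blast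
    have "card (verts G - {a}) = n + 1" using a(1) cv by simp
    then show ?thesis using contains_completeI[of "verts G - {a}"] a(2) by blast
  qed
qed

end

lemma not_bipartiteE:
  assumes "\<not> bipartite G" "graph G"
  shows "\<exists>u v. (u, v) \<in> arcs_ends G \<and> c u = (c v :: bool)"
proof (rule ccontr)
  assume no: "\<not> ?thesis"
  interpret simple_graph G using assms(2) unfolding simple_graph_def .
  have "bipartite G"
    unfolding bipartite_def
  proof (intro exI conjI ballI)
    show "{v \<in> verts G. c v} \<union> {v \<in> verts G. \<not> c v} = verts G" by blast
    show "{v \<in> verts G. c v} \<inter> {v \<in> verts G. \<not> c v} = {}" by blast
    fix e assume e: "e \<in> arcs_ends G"
    obtain u v where uv: "e = (u, v)" by (cases e)
    then have "u \<in> verts G" "v \<in> verts G" using e ug.E_V ug.E_V2 unfolding adj_def by blast+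
    then show "case e of (u, v) \<Rightarrow> u \<in> {v \<in> verts G. c v} \<and> v \<in> {v \<in> verts G. \<not> c v} \<or>
        u \<in> {v \<in> verts G. \<not> c v} \<and> v \<in> {v \<in> verts G. c v}"
      using no e uv by auto
  qed
  then show False using assms(1) by blast
qed

theorem theorem4:
  fixes G :: "('a, 'b) pre_digraph" and k :: nat
  assumes "graph G"
    and "3 \<le> k"
    and "k_connected 2 G"
    and "\<not> bipartite G"
    and "2 * k \<le> min_degree G"
  shows "k \<le> card (odd_cycle_lengths G) \<and>
    (card (odd_cycle_lengths G) = k \<longrightarrow>
      2 * card (odd_cycle_lengths G) + 1 = longest_odd_cycle_length G \<and>
      (contains_complete G (2 * k + 1) \<or> chromatic_number G \<le> 2 * k))"

proof -
  interpret simple_graph G using assms(1) unfolding simple_graph_def .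
  interpret two_connected_graph "verts G" adj by (rule two_connectedI[OF assms(3)])
  let ?L = "odd_cycle_lengths G"
  show ?thesis
  proof (cases "card ?L \<le> k")
    case False
    then show ?thesis by simp
  next
    case True
    interpret few_odd_cycles "verts G" adj k
      by unfold_locales (use assms(2) degree_ge[OF assms(5)] True odd_cycle_lengths_eq in auto)
    have "\<exists>u v. adj u v \<and> c u = c v" for c :: "'a \<Rightarrow> bool"
      using not_bipartiteE[OF assms(4,1)] unfolding adj_def by blast
    from odd_lengths_initial_segment[OF this]
    have L: "?L = {l. odd l \<and> 3 \<le> l \<and> l \<le> 2 * k + 1}" and V: "card (verts G) \<le> 2 * k + 2"
      unfolding odd_cycle_lengths_eq by blast+
    have img: "?L = (\<lambda>i. 2 * i + 1) ` {1..k}"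
      unfolding L
    proof (intro set_eqI iffI)
      fix l assume "l \<in> {l. odd l \<and> 3 \<le> l \<and> l \<le> 2 * k + 1}"
      then have l: "odd l" "3 \<le> l" "l \<le> 2 * k + 1" by auto
      obtain i where "l = 2 * i + 1" using l(1) by (elim oddE)
      then show "l \<in> (\<lambda>i. 2 * i + 1) ` {1..k}" using l by auto
    qed auto
    have card: "card ?L = k" unfolding img by (simp add: card_image inj_on_def)
    have "longest_odd_cycle_length G = 2 * k + 1"
      unfolding longest_odd_cycle_length_def
    proof (rule Max_eqI)
      show "finite ?L" unfolding img by simp
      show "l \<le> 2 * k + 1" if "l \<in> ?L" for l using that unfolding L by simp
      show "2 * k + 1 \<in> ?L" unfolding L using assms(2) by simp
    qed
    moreover have "contains_complete G (2 * k + 1) \<or> chromatic_number G \<le> 2 * k"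
    proof (rule complete_or_colorable)
      have "2 < card (verts G)" using assms(3) unfolding k_connected_def by blast
      then obtain v where v: "v \<in> verts G" by fastforce
      have "2 * k \<le> card {u. adj v u}" using degree_ge[OF assms(5) v] .
      also have "\<dots> \<le> card (verts G - {v})" using ug.E_V2 ug.E_irrefl by (intro card_mono) auto
      also have "\<dots> = card (verts G) - 1" using v by simp
      finally show "card (verts G) = 2 * k + 1 \<or> card (verts G) = 2 * k + 2"
        using V \<open>2 < card (verts G)\<close> by linarith
    qed (use assms in auto)
    ultimately show ?thesis using card by simp
  qed
qed

end
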